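(* Let $A$ be a contractible Banach algebra and let $V$ be a left Banach $A$-module whose underlying Banach space has the uniform Grothendieck approximation property (UGAP). Then the image of $A$ in $\mathcal{B}(V)$ under the action, that is, $\{\, (v\mapsto av) : a\in A\,\}\subset\mathcal{B}(V)$, is finite-dimensional.
   Context: A unital Banach algebra $A$ is contractible (also called super-amenable) if $H^1(A,V)=0$ for every Banach $A$-bimodule $V$; equivalently, if $A$ has a diagonal. A diagonal is an element $\sum_{i=1}^\infty c_i\otimes d_i$ of the projective tensor product $A\mathbin{\hat\otimes}A$ such that $\sum_{i=1}^\infty\|c_i\|\|d_i\|<+\infty$, $\sum_{i=1}^\infty ac_i\otimes d_i=\sum_{i=1}^\infty c_i\otimes d_ia$ in $A\mathbin{\hat\otimes}A$ for every $a\in A$, and $\sum_{i=1}^\infty c_id_i=1$. A left Banach $A$-module is a Banach space $V$ with a bounded bilinear map $A\times V\to V$, $(a,v)\mapsto av$, satisfying $(ab)v=a(bv)$. $\mathcal{B}(V)$ denotes the algebra of bounded linear operators on $V$. A Banach space $V$ has the approximation property (AP) if there is a net $(\varphi_k)$ of (bounded) finite-rank operators on $V$ which converges to $\mathrm{id}_V$ uniformly on compact subsets of $V$. A Banach space $V$ has the uniform Grothendieck approximation property (UGAP) if every ultrapower of $V$ has the AP. Here, for an ultrafilter $\mathcal{U}$ on an index set $I$, the ultrapower $V^{\mathcal{U}}$ is the quotient of the Banach space $\ell_\infty(I,V)$ of bounded families by the closed subspace of families $(v_n)_{n\in I}$ with $\lim_{\mathcal{U}}\|v_n\|=0$. *)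

theory Defs
  imports "HOL-Analysis.Analysis" "HOL-Library.Function_Algebras"
begin

section \<open>Normed spaces and Banach algebras over the real or complex field\<close>

text \<open>
  The scalar field is a type \<open>'k\<close> of sorts \<^class>\<open>real_normed_field\<close> and \<^class>\<open>heine_borel\<close>.
  Both \<open>real\<close> and \<open>complex\<close> are instances, and by Gelfand--Mazur every instance is isomorphic to one
  of these two as a real algebra. The scalar action is an explicit parameter, since the type classes provide
  multiplication by real scalars only.
\<close>

locale normed_space_over = vector_space smul
  for smul :: "'k::{real_normed_field,heine_borel} \<Rightarrow> 'v::real_normed_vector \<Rightarrow> 'v" +
  assumes scale_of_real: "smul (of_real r) v = r *\<^sub>R v"
    and norm_scale: "norm (smul c v) = norm c * norm v"

locale normed_algebra_over = normed_space_over smul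
  for smul :: "'k::{real_normed_field,heine_borel} \<Rightarrow> 'a::real_normed_algebra \<Rightarrow> 'a" +
  assumes scale_mult_left: "smul c (x * y) = smul c x * y"
    and scale_mult_right: "smul c (x * y) = x * smul c y"

text \<open>The module is not required to be unital, that is, \<open>act 1\<close> need not be the identity.\<close>

locale left_banach_module =
  A: normed_algebra_over scaleA + V: normed_space_over scaleV + bounded_bilinear act
  for scaleA :: "'k::{real_normed_field,heine_borel} \<Rightarrow> 'a::{real_normed_algebra,banach} \<Rightarrow> 'a"
    and scaleV :: "'k \<Rightarrow> 'v::banach \<Rightarrow> 'v"
    and act :: "'a \<Rightarrow> 'v \<Rightarrow> 'v" +
  assumes act_scale_left: "act (scaleA c a) v = scaleV c (act a v)"
    and act_scale_right: "act a (scaleV c v) = scaleV c (act a v)"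
    and act_mult: "act (a * b) v = act a (act b v)"

definition pointwise_scale :: "('k \<Rightarrow> 'v \<Rightarrow> 'v) \<Rightarrow> 'k \<Rightarrow> ('x \<Rightarrow> 'v) \<Rightarrow> 'x \<Rightarrow> 'v" where
  "pointwise_scale smul c f = (\<lambda>x. smul c (f x))"

lemma (in vector_space) vector_space_pointwise: "vector_space (pointwise_scale scale)"
  by unfold_locales
    (auto simp: pointwise_scale_def fun_eq_iff scale_right_distrib scale_left_distrib)

text \<open>A set of vectors is finite-dimensional if its linear span is.\<close>

definition finite_dimensional :: "('k::field \<Rightarrow> 'x::ab_group_add \<Rightarrow> 'x) \<Rightarrow> 'x set \<Rightarrow> bool" where
  "finite_dimensional smul S \<longleftrightarrow> (\<exists>B. finite B \<and> S \<subseteq> module.span smul B)"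


section \<open>The projective tensor product and contractibility\<close>

text \<open>
  The algebraic tensor product is the free vector space on \<open>'a \<times> 'b\<close> (finitely supported
  functions \<open>'a \<times> 'b \<Rightarrow> 'k\<close>) modulo the span of the bilinearity relations.
\<close>

definition tens :: "'a \<Rightarrow> 'b \<Rightarrow> 'a \<times> 'b \<Rightarrow> 'k::field" where
  "tens a b = (\<lambda>p. if p = (a, b) then 1 else 0)"

definition tensor_relations ::
  "('k::field \<Rightarrow> 'a::ab_group_add \<Rightarrow> 'a) \<Rightarrow> ('k \<Rightarrow> 'b::ab_group_add \<Rightarrow> 'b) \<Rightarrow> ('a \<times> 'b \<Rightarrow> 'k) set"
  where
  "tensor_relations scaleA scaleB =
     {tens (a + a') b - tens a b - tens a' b | a a' b. True} \<union>
     {tens a (b + b') - tens a b - tens a b' | a b b'. True} \<union>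
     {tens (scaleA r a) b - pointwise_scale (*) r (tens a b) | r a b. True} \<union>
     {tens a (scaleB r b) - pointwise_scale (*) r (tens a b) | r a b. True}"

definition tensor_null ::
  "('k::field \<Rightarrow> 'a::ab_group_add \<Rightarrow> 'a) \<Rightarrow> ('k \<Rightarrow> 'b::ab_group_add \<Rightarrow> 'b) \<Rightarrow> ('a \<times> 'b \<Rightarrow> 'k) set"
  where
  "tensor_null scaleA scaleB = module.span (pointwise_scale (*)) (tensor_relations scaleA scaleB)"

definition projective_norm ::
  "('k::field \<Rightarrow> 'a::real_normed_vector \<Rightarrow> 'a) \<Rightarrow> ('k \<Rightarrow> 'b::real_normed_vector \<Rightarrow> 'b) \<Rightarrow>
   ('a \<times> 'b \<Rightarrow> 'k) \<Rightarrow> real" where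
  "projective_norm scaleA scaleB u =
     Inf {(\<Sum>(a, b)\<leftarrow>xs. norm a * norm b) | xs.
            u - (\<Sum>(a, b)\<leftarrow>xs. tens a b) \<in> tensor_null scaleA scaleB}"

text \<open>
  The projective tensor product is the completion (Cauchy sequences modulo null sequences) of the
  algebraic tensor product for the projective norm. Two series whose partial sums are Cauchy thus
  have the same sum in it iff the differences of their partial sums form a null sequence. Below,
  this is only used for absolutely convergent series, which have Cauchy partial sums.
\<close>

definition projective_sum_eq ::
  "('k::field \<Rightarrow> 'a::real_normed_vector \<Rightarrow> 'a) \<Rightarrow> ('k \<Rightarrow> 'b::real_normed_vector \<Rightarrow> 'b) \<Rightarrow>
   (nat \<Rightarrow> 'a \<times> 'b) \<Rightarrow> (nat \<Rightarrow> 'a \<times> 'b) \<Rightarrow> bool" where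
  "projective_sum_eq scaleA scaleB s t \<longleftrightarrow>
     (\<lambda>n. projective_norm scaleA scaleB
            ((\<Sum>i<n. tens (fst (s i)) (snd (s i))) - (\<Sum>i<n. tens (fst (t i)) (snd (t i)))))
       \<longlonglongrightarrow> 0"

definition is_diagonal ::
  "('k::field \<Rightarrow> 'a::{real_normed_algebra,monoid_mult} \<Rightarrow> 'a) \<Rightarrow> (nat \<Rightarrow> 'a) \<Rightarrow> (nat \<Rightarrow> 'a) \<Rightarrow> bool"
  where
  "is_diagonal smul c d \<longleftrightarrow>
     summable (\<lambda>i. norm (c i) * norm (d i)) \<and>
     (\<forall>a. projective_sum_eq smul smul (\<lambda>i. (a * c i, d i)) (\<lambda>i. (c i, d i * a))) \<and>
     (\<lambda>i. c i * d i) sums 1"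

definition contractible_algebra ::
  "('k::field \<Rightarrow> 'a::{real_normed_algebra,monoid_mult} \<Rightarrow> 'a) \<Rightarrow> bool" where
  "contractible_algebra smul \<longleftrightarrow> (\<exists>c d. is_diagonal smul c d)"


section \<open>The approximation property\<close>

text \<open>
  Ultrapowers depend on an ultrafilter and hence are not types, so the approximation property is
  formulated for normed spaces given by an explicit carrier.
\<close>

record ('k, 'x) normed_space =
  pts :: "'x set"
  nadd :: "'x \<Rightarrow> 'x \<Rightarrow> 'x"
  nscale :: "'k \<Rightarrow> 'x \<Rightarrow> 'x"
  nnorm :: "'x \<Rightarrow> real"

text \<open>The value \<open>0\<close> off the carrier is a convention required by \<^locale>\<open>Metric_space\<close>.\<close>

definition ndist :: "('k::field, 'x) normed_space \<Rightarrow> 'x \<Rightarrow> 'x \<Rightarrow> real" where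
  "ndist E x y =
     (if x \<in> pts E \<and> y \<in> pts E then nnorm E (nadd E x (nscale E (- 1) y)) else 0)"

definition ntopology :: "('k::field, 'x) normed_space \<Rightarrow> 'x topology" where
  "ntopology E = Metric_space.mtopology (pts E) (ndist E)"

definition nsubspace :: "('k, 'x) normed_space \<Rightarrow> 'x set \<Rightarrow> bool" where
  "nsubspace E S \<longleftrightarrow> S \<subseteq> pts E \<and> S \<noteq> {} \<and>
     (\<forall>x\<in>S. \<forall>y\<in>S. nadd E x y \<in> S) \<and> (\<forall>c. \<forall>x\<in>S. nscale E c x \<in> S)"

definition nspan :: "('k, 'x) normed_space \<Rightarrow> 'x set \<Rightarrow> 'x set" where
  "nspan E B = \<Inter> {S. nsubspace E S \<and> B \<subseteq> S}"

definition bounded_operator :: "('k, 'x) normed_space \<Rightarrow> ('x \<Rightarrow> 'x) \<Rightarrow> bool" where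
  "bounded_operator E f \<longleftrightarrow>
     (\<forall>x\<in>pts E. f x \<in> pts E) \<and>
     (\<forall>x\<in>pts E. \<forall>y\<in>pts E. f (nadd E x y) = nadd E (f x) (f y)) \<and>
     (\<forall>c. \<forall>x\<in>pts E. f (nscale E c x) = nscale E c (f x)) \<and>
     (\<exists>C. \<forall>x\<in>pts E. nnorm E (f x) \<le> C * nnorm E x)"

definition finite_rank :: "('k, 'x) normed_space \<Rightarrow> ('x \<Rightarrow> 'x) \<Rightarrow> bool" where
  "finite_rank E f \<longleftrightarrow> (\<exists>B. finite B \<and> B \<subseteq> pts E \<and> f ` pts E \<subseteq> nspan E B)"

text \<open>Nets of operators are represented by proper filters on the space of operators.\<close>

definition approximation_property :: "('k::field, 'x) normed_space \<Rightarrow> bool" where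
  "approximation_property E \<longleftrightarrow>
     (\<exists>F :: ('x \<Rightarrow> 'x) filter. F \<noteq> bot \<and>
        (\<forall>\<^sub>F f in F. bounded_operator E f \<and> finite_rank E f) \<and>
        (\<forall>K. compactin (ntopology E) K \<longrightarrow>
           (\<forall>e>0. \<forall>\<^sub>F f in F. \<forall>x\<in>K. ndist E (f x) x < e)))"


section \<open>Ultrapowers and the uniform Grothendieck approximation property\<close>

definition ultrafilter :: "'i filter \<Rightarrow> bool" where
  "ultrafilter U \<longleftrightarrow> U \<noteq> bot \<and> (\<forall>P. eventually P U \<or> eventually (\<lambda>i. \<not> P i) U)"

definition bounded_families :: "('i \<Rightarrow> 'v::real_normed_vector) set" where
  "bounded_families = {v. bounded (range v)}"

definition null_families :: "'i filter \<Rightarrow> ('i \<Rightarrow> 'v::real_normed_vector) set" where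
  "null_families U = {v \<in> bounded_families. ((\<lambda>i. norm (v i)) \<longlongrightarrow> 0) U}"

definition ultra_class :: "'i filter \<Rightarrow> ('i \<Rightarrow> 'v::real_normed_vector) \<Rightarrow> ('i \<Rightarrow> 'v) set" where
  "ultra_class U v = {w \<in> bounded_families. w - v \<in> null_families U}"

text \<open>
  The quotient of the bounded families by the null families, with the quotient of the supremum
  norm. The operations are defined through chosen representatives; see
  \<open>ultra_class_add\<close> and \<open>ultra_class_scale\<close> below.
\<close>

definition ultrapower ::
  "('k \<Rightarrow> 'v::real_normed_vector \<Rightarrow> 'v) \<Rightarrow> 'i filter \<Rightarrow> ('k, ('i \<Rightarrow> 'v) set) normed_space" where
  "ultrapower smul U =
     \<lparr> pts = ultra_class U ` bounded_families,
       nadd = (\<lambda>X Y. ultra_class U ((SOME x. x \<in> X) + (SOME y. y \<in> Y))),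
       nscale = (\<lambda>c X. ultra_class U (pointwise_scale smul c (SOME x. x \<in> X))),
       nnorm = (\<lambda>X. INF x\<in>X. SUP i. norm (x i)) \<rparr>"

text \<open>
  HOL cannot quantify over all index types inside a formula, so the index type is a parameter.
  An ultrafilter on a subset \<open>I\<close> of \<open>'i\<close> amounts to an ultrafilter on \<open>'i\<close> containing \<open>I\<close>,
  with the same ultrapowers up to isometry.
\<close>

definition UGAP :: "'i itself \<Rightarrow> ('k::field \<Rightarrow> 'v::real_normed_vector \<Rightarrow> 'v) \<Rightarrow> bool" where
  "UGAP _ smul \<longleftrightarrow>
     (\<forall>U :: 'i filter. ultrafilter U \<longrightarrow> approximation_property (ultrapower smul U))"

subsection \<open>The ultrapower is a metric space with well-defined operations\<close>

lemma pts_ultrapower: "pts (ultrapower smul U) = ultra_class U ` bounded_families"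
  by (simp add: ultrapower_def)

lemma bounded_families_iff: "v \<in> bounded_families \<longleftrightarrow> (\<exists>C. \<forall>i. norm (v i) \<le> C)"
  by (auto simp: bounded_families_def bounded_iff)

lemma bounded_families_add:
  assumes "v \<in> bounded_families" "w \<in> bounded_families"
  shows "v + w \<in> bounded_families"
proof -
  obtain C D where "\<And>i. norm (v i) \<le> C" "\<And>i. norm (w i) \<le> D"
    using assms by (auto simp: bounded_families_iff)
  then have "\<And>i. norm ((v + w) i) \<le> C + D"
    by (simp add: norm_triangle_mono)
  then show ?thesis by (auto simp: bounded_families_iff)
qed

lemma bounded_families_minus: "v \<in> bounded_families \<Longrightarrow> - v \<in> bounded_families"
  by (auto simp: bounded_families_iff)

lemma bounded_families_diff:
  "v \<in> bounded_families \<Longrightarrow> w \<in> bounded_families \<Longrightarrow> v - w \<in> bounded_families"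
  using bounded_families_add[of v "- w"] bounded_families_minus[of w] by simp

lemma null_families_alt: "v \<in> null_families U \<longleftrightarrow> v \<in> bounded_families \<and> (v \<longlongrightarrow> 0) U"
  by (auto simp: null_families_def tendsto_norm_zero_iff)

lemma null_families_add:
  "v \<in> null_families U \<Longrightarrow> w \<in> null_families U \<Longrightarrow> v + w \<in> null_families U"
  using tendsto_add[of v 0 U w 0] bounded_families_add[of v w]
  by (auto simp: null_families_alt plus_fun_def)

lemma null_families_minus: "v \<in> null_families U \<Longrightarrow> - v \<in> null_families U"
  using tendsto_minus[of v 0 U] bounded_families_minus[of v]
  by (auto simp: null_families_alt fun_Compl_def)

lemma ultra_class_self: "v \<in> bounded_families \<Longrightarrow> v \<in> ultra_class U v"
  by (auto simp: ultra_class_def null_families_alt bounded_families_iff zero_fun_def)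

lemma ultra_class_eq_iff:
  assumes "v \<in> bounded_families" "w \<in> bounded_families"
  shows "ultra_class U v = ultra_class U w \<longleftrightarrow> v - w \<in> null_families U"
proof
  assume "ultra_class U v = ultra_class U w"
  then show "v - w \<in> null_families U"
    using ultra_class_self[OF assms(1), of U] by (auto simp: ultra_class_def)
next
  assume *: "v - w \<in> null_families U"
  have "x - v \<in> null_families U \<longleftrightarrow> x - w \<in> null_families U" for x
    using null_families_add[OF _ *, of "x - v"]
      null_families_add[OF _ null_families_minus[OF *], of "x - w"] by auto
  then show "ultra_class U v = ultra_class U w"
    by (auto simp: ultra_class_def)
qed

lemma ultra_class_representative:
  assumes "v \<in> bounded_families"
  shows "(SOME x. x \<in> ultra_class U v) \<in> bounded_families"
    and "(SOME x. x \<in> ultra_class U v) - v \<in> null_families U"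
  using someI[of "\<lambda>x. x \<in> ultra_class U v", OF ultra_class_self[OF assms]]
  by (auto simp: ultra_class_def)

lemma ultra_class_add:
  assumes "v \<in> bounded_families" "w \<in> bounded_families"
  shows "nadd (ultrapower smul U) (ultra_class U v) (ultra_class U w) = ultra_class U (v + w)"
proof -
  let ?v = "SOME x. x \<in> ultra_class U v" and ?w = "SOME x. x \<in> ultra_class U w"
  have "(?v + ?w) - (v + w) = (?v - v) + (?w - w)" by simp
  also have "\<dots> \<in> null_families U"
    using ultra_class_representative(2) assms by (intro null_families_add)
  finally have "ultra_class U (?v + ?w) = ultra_class U (v + w)"
    using assms by (subst ultra_class_eq_iff)
      (auto intro: bounded_families_add ultra_class_representative(1))
  then show ?thesis by (simp add: ultrapower_def)
qed

context normed_space_over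
begin

lemma bounded_families_scale:
  assumes "v \<in> bounded_families"
  shows "pointwise_scale smul c v \<in> bounded_families"
proof -
  obtain C where "\<And>i. norm (v i) \<le> C" using assms by (auto simp: bounded_families_iff)
  then have "\<And>i. norm (pointwise_scale smul c v i) \<le> norm c * C"
    by (simp add: pointwise_scale_def norm_scale mult_left_mono)
  then show ?thesis by (auto simp: bounded_families_iff)
qed

lemma null_families_scale:
  assumes "v \<in> null_families U"
  shows "pointwise_scale smul c v \<in> null_families U"
  using assms bounded_families_scale[of v c] tendsto_mult_right_zero[of "\<lambda>i. norm (v i)" U "norm c"]
  by (simp add: null_families_def pointwise_scale_def norm_scale)

lemma ultra_class_scale:
  assumes "v \<in> bounded_families"
  shows "nscale (ultrapower smul U) c (ultra_class U v) = ultra_class U (pointwise_scale smul c v)"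
proof -
  let ?v = "SOME x. x \<in> ultra_class U v"
  have "pointwise_scale smul c ?v - pointwise_scale smul c v = pointwise_scale smul c (?v - v)"
    by (simp add: pointwise_scale_def fun_eq_iff scale_right_diff_distrib)
  also have "\<dots> \<in> null_families U"
    using ultra_class_representative(2)[OF assms] by (rule null_families_scale)
  finally show ?thesis
    using assms ultra_class_representative(1)[OF assms, of U]
    by (simp add: ultrapower_def ultra_class_eq_iff bounded_families_scale)
qed

lemma ndist_ultra_class:
  assumes "v \<in> bounded_families" "w \<in> bounded_families"
  shows "ndist (ultrapower smul U) (ultra_class U v) (ultra_class U w) =
           nnorm (ultrapower smul U) (ultra_class U (v - w))"
proof -
  have "pointwise_scale smul (- 1) w = - w"
    by (simp add: pointwise_scale_def fun_eq_iff)
  then show ?thesis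
    using assms by (simp add: ndist_def pts_ultrapower ultra_class_scale ultra_class_add bounded_families_minus)
qed

end

text \<open>The quotient norm is the limit of the norms along the ultrafilter.\<close>

lemma nnorm_ultra_class:
  fixes v :: "'i \<Rightarrow> 'v::real_normed_vector"
  assumes v: "v \<in> bounded_families" and U: "ultrafilter U"
  shows "((\<lambda>i. norm (v i)) \<longlongrightarrow> nnorm (ultrapower smul U) (ultra_class U v)) U"
proof (rule tendstoI)
  fix e :: real assume e: "e > 0"
  define L where "L = nnorm (ultrapower smul U) (ultra_class U v)"
  have L: "L = (INF x\<in>ultra_class U v. SUP i. norm (x i))"
    by (simp add: L_def ultrapower_def)
  have bdd: "bdd_above (range (\<lambda>i. norm (x i)))" if "x \<in> bounded_families" for x :: "'i \<Rightarrow> 'v"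
    using that by (auto simp: bounded_families_iff bdd_above_def)
  have sup0: "0 \<le> (SUP i. norm (x i))" if "x \<in> bounded_families" for x :: "'i \<Rightarrow> 'v"
    using cSUP_upper[OF UNIV_I bdd[OF that]] norm_ge_zero order_trans by blast
  have bb: "bdd_below ((\<lambda>x. SUP i. norm (x i)) ` ultra_class U v)"
    using sup0 by (intro bdd_belowI[of _ 0]) (auto simp: ultra_class_def)
  have ne: "ultra_class U v \<noteq> {}" using ultra_class_self[OF v] by blast
  have upper: "\<forall>\<^sub>F i in U. norm (v i) < L + e"
  proof -
    have "(INF x\<in>ultra_class U v. SUP i. norm (x i)) < L + e / 2" using e L by simp
    then obtain x where x: "x \<in> ultra_class U v" "(SUP i. norm (x i)) < L + e / 2"
      using cINF_less_iff[OF ne bb] by blast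
    have "((\<lambda>i. norm ((x - v) i)) \<longlongrightarrow> 0) U"
      using x by (auto simp: ultra_class_def null_families_def)
    then have "\<forall>\<^sub>F i in U. norm ((x - v) i) < e / 2"
      using e by (intro order_tendstoD(2)[of _ 0]) simp_all
    then show ?thesis
    proof eventually_elim
      case (elim i)
      have "norm (x i) \<le> (SUP i. norm (x i))"
        using x by (intro cSUP_upper bdd) (auto simp: ultra_class_def)
      then show ?case
        using elim x norm_triangle_ineq2[of "v i" "x i"] by (simp add: norm_minus_commute)
    qed
  qed
  have lower: "\<forall>\<^sub>F i in U. L - e < norm (v i)"
  proof (rule ccontr)
    assume "\<not> ?thesis"
    then have ev: "\<forall>\<^sub>F i in U. norm (v i) \<le> L - e"
      using U by (auto simp: ultrafilter_def not_less)
    define x where "x = (\<lambda>i. if norm (v i) \<le> L - e then v i else 0)"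
    have xb: "x \<in> bounded_families"
    proof -
      obtain C where C: "\<And>i. norm (v i) \<le> C" using v by (auto simp: bounded_families_iff)
      then have "norm (x i) \<le> C" for i
        using C[of i] order_trans[OF norm_ge_zero C[of i]] by (simp add: x_def)
      then show ?thesis by (auto simp: bounded_families_iff)
    qed
    have "\<forall>\<^sub>F i in U. norm ((x - v) i) = 0"
      using ev by eventually_elim (simp add: x_def)
    then have "((\<lambda>i. norm ((x - v) i)) \<longlongrightarrow> 0) U"
      by (rule tendsto_eventually)
    then have "x \<in> ultra_class U v"
      using xb bounded_families_diff[OF xb v] by (simp add: ultra_class_def null_families_def)
    then have "L \<le> (SUP i. norm (x i))" unfolding L by (rule cINF_lower[OF bb])
    moreover have "\<exists>i. norm (v i) \<le> L - e"
      using ev U eventually_happens' by (auto simp: ultrafilter_def)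
    then have "0 \<le> L - e" using norm_ge_zero order_trans by blast
    then have "(SUP i. norm (x i)) \<le> L - e"
      by (intro cSUP_least) (auto simp: x_def)
    ultimately show False using e by simp
  qed
  show "\<forall>\<^sub>F i in U. dist (norm (v i)) (nnorm (ultrapower smul U) (ultra_class U v)) < e"
    using upper lower by eventually_elim (auto simp: dist_real_def L_def)
qed

lemma (in normed_space_over) Metric_space_ultrapower:
  fixes U :: "'i filter"
  assumes U: "ultrafilter U"
  shows "Metric_space (pts (ultrapower smul U)) (ndist (ultrapower smul U))"
proof -
  let ?E = "ultrapower smul U"
  have nb: "U \<noteq> bot" using U by (simp add: ultrafilter_def)
  have lim: "((\<lambda>i. norm (v i - w i)) \<longlongrightarrow> ndist ?E (ultra_class U v) (ultra_class U w)) U"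
    if "v \<in> bounded_families" "w \<in> bounded_families" for v w
    using nnorm_ultra_class[OF bounded_families_diff[OF that] U, of smul] that
    by (simp add: ndist_ultra_class)
  have zero: "ndist ?E (ultra_class U v) (ultra_class U w) = 0 \<longleftrightarrow> ultra_class U v = ultra_class U w"
    if "v \<in> bounded_families" "w \<in> bounded_families" for v w
    using lim[OF that] tendsto_unique[OF nb lim[OF that], of 0] bounded_families_diff[OF that]
    by (auto simp: ultra_class_eq_iff[OF that] null_families_def)
  have nonneg: "0 \<le> ndist ?E (ultra_class U v) (ultra_class U w)"
    if "v \<in> bounded_families" "w \<in> bounded_families" for v w
    using lim[OF that] by (rule tendsto_lowerbound) (auto simp: nb)
  have comm: "ndist ?E (ultra_class U v) (ultra_class U w) = ndist ?E (ultra_class U w) (ultra_class U v)"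
    if "v \<in> bounded_families" "w \<in> bounded_families" for v w
    using tendsto_unique[OF nb lim[OF that]] lim[OF that(2,1)] by (simp add: norm_minus_commute)
  have tri: "ndist ?E (ultra_class U u) (ultra_class U w) \<le>
      ndist ?E (ultra_class U u) (ultra_class U v) + ndist ?E (ultra_class U v) (ultra_class U w)"
    if "u \<in> bounded_families" "v \<in> bounded_families" "w \<in> bounded_families" for u v w
    by (rule tendsto_le[OF nb tendsto_add[OF lim[OF that(1,2)] lim[OF that(2,3)]] lim[OF that(1,3)]])
      (intro always_eventually allI, metis diff_add_cancel add_diff_eq norm_triangle_ineq)
  have p: "pts ?E = ultra_class U ` bounded_families" by (simp add: ultrapower_def)
  show ?thesis
  proof
    show "0 \<le> ndist ?E X Y" for X Y
    proof (cases "X \<in> pts ?E \<and> Y \<in> pts ?E")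
      case True
      then show ?thesis using nonneg by (auto simp: p)
    next
      case False
      then show ?thesis by (auto simp: ndist_def)
    qed
    show "ndist ?E X Y = ndist ?E Y X" for X Y
    proof (cases "X \<in> pts ?E \<and> Y \<in> pts ?E")
      case True
      then show ?thesis using comm by (auto simp: p)
    next
      case False
      then show ?thesis by (auto simp: ndist_def)
    qed
  qed (use zero tri in \<open>auto simp: p\<close>)
qed

end

theory Submission
  imports Defs
begin

text \<open>
  A diagonal \<open>\<Sum> c\<^sub>i \<otimes> d\<^sub>i\<close> turns a bounded operator \<open>T\<close> on \<open>V\<close> into the operator
  \<open>\<Phi> T = \<Sum> c\<^sub>i T d\<^sub>i\<close>, which commutes with the action of \<open>A\<close> (\<open>act_averaged\<close>). If \<open>T\<close> is close to the
  identity on the vectors \<open>d\<^sub>i v\<close>, then \<open>\<Phi> T v\<close> is close to \<open>\<Sum> c\<^sub>i d\<^sub>i v = 1 v\<close>. After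
  rescaling, the \<open>d\<^sub>i v\<close> form a null sequence, so the approximation property supplies such a \<open>T\<close> of
  finite rank for each single \<open>v\<close>.

  The uniform property makes the rank and the norm of \<open>T\<close> independent of \<open>v\<close> in the unit ball
  (\<open>averageable_if_UGAP\<close>). Otherwise there are vectors \<open>v\<^sub>n\<close> for which rank and norm \<open>n\<close> do not
  suffice. They form one vector \<open>w\<close> of an ultrapower, where one finite-rank operator is good for
  all \<open>d\<^sub>i w\<close>. Its coordinate functionals live on the ultrapower, but by the Hahn--Banach theorem
  their values at finitely many \<open>d\<^sub>i w\<close> are approximated by the values at \<open>d\<^sub>i v\<^sub>n\<close> of functionals on
  \<open>V\<close> of comparable norm (\<open>functional_descent\<close>). This gives good operators of bounded rank and norm
  for infinitely many \<open>v\<^sub>n\<close>, a contradiction. As the scalar field is abstract, the extension theorem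
  first needs that it is finite-dimensional over the reals (\<open>scalar_field_basis\<close>).

  Uniformity implies finite dimension as follows (\<open>finite_dimensional_if_averageable\<close>). Let
  \<open>T\<^sub>v = \<Sum>\<^sub>j f\<^sub>v\<^sub>j \<otimes> x\<^sub>v\<^sub>j\<close> be the operator for \<open>v\<close>. The scalars \<open>f\<^sub>v\<^sub>j (d\<^sub>i v)\<close> with \<open>i < m\<close> and
  \<open>j < M\<close> stay in a bounded set, so up to a small error they are already attained at finitely many
  representatives \<open>r\<close>. Hence
  \<open>\<Psi> = \<Sum>\<^sub>j \<Sum>\<^sub>i f\<^sub>r\<^sub>j (d\<^sub>i r) c\<^sub>i x\<^sub>v\<^sub>j\<close> is still close to \<open>1 v\<close>, and the diagonal identity gives
  \<open>a \<Psi> = \<Sum>\<^sub>j \<Sum>\<^sub>i f\<^sub>r\<^sub>j (d\<^sub>i a r) c\<^sub>i x\<^sub>v\<^sub>j\<close>. If \<open>a\<close> lies in the kernels of the finitely many functionals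
  \<open>a \<mapsto> f\<^sub>r\<^sub>j (d\<^sub>i a r)\<close> with \<open>i < m\<close>, only a small tail remains. So \<open>\<parallel>a v\<parallel>\<close> is at most half
  the operator norm of \<open>a\<close> for all \<open>v\<close> in the unit ball, which forces \<open>a\<close> to act as zero. A linear map whose
  kernel contains a finite intersection of kernels of functionals has finite-dimensional image.
\<close>


section \<open>Coordinates in seminormed spaces\<close>

text \<open>
  The seminorm is only controlled on a subspace, because it will be the limit of norms along an
  ultrafilter, which is meaningful for bounded families only. The same facts are applied to the
  scalar field itself, as a normed space over the reals.
\<close>

locale seminormed_space = vector_space scale
  for scale :: "'k::{real_normed_field,heine_borel} \<Rightarrow> 'v::ab_group_add \<Rightarrow> 'v" (infixr "*s" 75) +
  fixes S :: "'v set" and N :: "'v \<Rightarrow> real"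
  assumes subspace_S: "subspace S"
    and triangle: "x \<in> S \<Longrightarrow> y \<in> S \<Longrightarrow> N (x + y) \<le> N x + N y"
    and N_scale: "x \<in> S \<Longrightarrow> N (c *s x) = norm c * N x"
begin

lemma N_zero: "N 0 = 0"
  using N_scale[of 0 0] subspace_0[OF subspace_S] by simp

lemma N_minus: "x \<in> S \<Longrightarrow> N (- x) = N x"
  using N_scale[of x "- 1"] by simp

lemma N_nonneg: "x \<in> S \<Longrightarrow> 0 \<le> N x"
  using triangle[of x "- x"] N_minus[of x] subspace_neg[OF subspace_S, of x] by (simp add: N_zero)

lemma triangle_diff: "x \<in> S \<Longrightarrow> y \<in> S \<Longrightarrow> N (x - y) \<le> N x + N y"
  using triangle[of x "- y"] N_minus[of y] subspace_neg[OF subspace_S, of y] by simp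

definition comb :: "'v set \<Rightarrow> ('v \<Rightarrow> 'k) \<Rightarrow> 'v" where
  "comb J t = (\<Sum>b\<in>J. t b *s b)"

lemma comb_in: "J \<subseteq> S \<Longrightarrow> comb J t \<in> S"
  unfolding comb_def using subspace_S by (intro subspace_sum subspace_scale) auto

lemma comb_add: "comb J (\<lambda>b. s b + t b) = comb J s + comb J t"
  by (simp add: comb_def scale_left_distrib sum.distrib)

lemma comb_diff: "comb J (\<lambda>b. s b - t b) = comb J s - comb J t"
  by (simp add: comb_def scale_left_diff_distrib sum_subtractf)

lemma comb_scale: "comb J (\<lambda>b. c * t b) = c *s comb J t"
  by (simp add: comb_def scale_sum_right)

lemma N_comb_le: "finite J \<Longrightarrow> J \<subseteq> S \<Longrightarrow> N (comb J t) \<le> (\<Sum>b\<in>J. norm (t b) * N b)"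
proof (induction J rule: finite_induct)
  case empty
  then show ?case by (simp add: comb_def N_zero)
next
  case (insert b J)
  have "N (comb (insert b J) t) \<le> N (t b *s b) + N (comb J t)"
    using insert subspace_scale[OF subspace_S] comb_in[of J]
    by (simp add: comb_def triangle)
  then show ?case using insert N_scale[of b "t b"] by simp
qed

text \<open>
  Linear independence modulo the null space of \<open>N\<close>, in the quantitative form that the coordinates
  of a linear combination are bounded by its seminorm.
\<close>

definition stably_independent :: "real \<Rightarrow> 'v set \<Rightarrow> bool" where
  "stably_independent c J \<longleftrightarrow> c > 0 \<and> (\<forall>t. \<forall>b\<in>J. c * norm (t b) \<le> N (comb J t))"

text \<open>
  Finite-dimensional subspaces are closed: the coordinates of approximating combinations are Cauchy,
  and the scalar field is complete.
\<close>

lemma stably_independent_closed: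
  assumes J: "finite J" "J \<subseteq> S" and st: "stably_independent c J" and y: "y \<in> S"
    and approx: "\<And>e. e > 0 \<Longrightarrow> \<exists>t. N (y - comb J t) < e"
  shows "\<exists>t. N (y - comb J t) = 0"
proof -
  have "\<forall>n. \<exists>t. N (y - comb J t) < inverse (Suc n)" using approx by simp
  then obtain t where t: "\<And>n. N (y - comb J (t n)) < inverse (Suc n)" by metis
  have c: "c > 0" using st by (simp add: stably_independent_def)
  have inS: "y - comb J s \<in> S" for s
    using y comb_in[OF J(2)] subspace_diff[OF subspace_S] by blast
  have "Cauchy (\<lambda>n. t n b)" if b: "b \<in> J" for b
  proof (rule metric_CauchyI)
    fix e :: real assume e: "e > 0"
    obtain M :: nat where M: "inverse (Suc M) < c * e / 2"
      using reals_Archimedean[of "c * e / 2"] c e by auto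
    have "dist (t m b) (t n b) < e" if "m \<ge> M" "n \<ge> M" for m n
    proof -
      have le: "inverse (real (Suc k)) \<le> inverse (real (Suc M))" if "k \<ge> M" for k
        using that by (intro le_imp_inverse_le) auto
      have "c * norm (t m b - t n b) \<le> N (comb J (\<lambda>b. t m b - t n b))"
        using st b by (auto simp: stably_independent_def)
      also have "comb J (\<lambda>b. t m b - t n b) = (y - comb J (t n)) - (y - comb J (t m))"
        by (simp add: comb_diff)
      also have "N \<dots> \<le> N (y - comb J (t n)) + N (y - comb J (t m))"
        by (rule triangle_diff[OF inS inS])
      also have "\<dots> < c * e"
        using t[of n] t[of m] le[OF that(1)] le[OF that(2)] M by linarith
      finally show ?thesis using c by (simp add: dist_norm)
    qed
    then show "\<exists>M. \<forall>m\<ge>M. \<forall>n\<ge>M. dist (t m b) (t n b) < e" by blast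
  qed
  then have "\<forall>b\<in>J. \<exists>l. (\<lambda>n. t n b) \<longlonglongrightarrow> l"
    by (auto simp: Cauchy_convergent_iff convergent_def)
  then obtain l where l: "\<And>b. b \<in> J \<Longrightarrow> (\<lambda>n. t n b) \<longlonglongrightarrow> l b" by metis
  have "N (y - comb J l) \<le> inverse (Suc n) + (\<Sum>b\<in>J. norm (t n b - l b) * N b)" for n
  proof -
    have "N (y - comb J l) = N ((y - comb J (t n)) + comb J (\<lambda>b. t n b - l b))"
      by (simp add: comb_diff)
    also have "\<dots> \<le> N (y - comb J (t n)) + N (comb J (\<lambda>b. t n b - l b))"
      by (rule triangle[OF inS comb_in[OF J(2)]])
    finally show ?thesis
      using t[of n] N_comb_le[OF J, of "\<lambda>b. t n b - l b"] by linarith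
  qed
  moreover have "(\<lambda>n. inverse (real (Suc n)) + (\<Sum>b\<in>J. norm (t n b - l b) * N b)) \<longlonglongrightarrow> 0 + (\<Sum>b\<in>J. norm (l b - l b) * N b)"
    by (intro tendsto_intros l LIMSEQ_inverse_real_of_nat)
  ultimately have "N (y - comb J l) \<le> 0"
    by (intro LIMSEQ_le_const[where X = "\<lambda>n. inverse (real (Suc n)) + (\<Sum>b\<in>J. norm (t n b - l b) * N b)"]) auto
  then show ?thesis using N_nonneg[OF inS, of l] by (intro exI[of _ l]) simp
qed

text \<open>
  The distance \<open>d\<close> from \<open>b\<close> to the combinations of \<open>J\<close> bounds the coordinate of \<open>b\<close>. Subtracting
  the \<open>b\<close>-component then bounds the other coordinates.
\<close>

lemma stably_independent_insert:
  assumes J: "finite J" "J \<subseteq> S" and st: "stably_independent c J" and b: "b \<in> S" "b \<notin> J"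
    and d: "d > 0" "\<And>t. d \<le> N (b - comb J t)"
  shows "\<exists>c. stably_independent c (insert b J)"
proof -
  have c: "c > 0" using st by (simp add: stably_independent_def)
  define c' where "c' = min d (c / (1 + N b / d))"
  have Nb: "N b \<ge> 0" by (rule N_nonneg[OF b(1)])
  have c': "c' > 0" using c d Nb by (auto simp: c'_def intro!: divide_pos_pos add_pos_nonneg)
  have "c' * norm (t x) \<le> N (comb (insert b J) t)" if x: "x \<in> insert b J" for t x
  proof -
    let ?n = "N (comb (insert b J) t)"
    have eq: "comb (insert b J) t = t b *s b + comb J t" using J b by (simp add: comb_def)
    have n0: "?n \<ge> 0" using J b by (intro N_nonneg comb_in) auto
    have tb: "d * norm (t b) \<le> ?n"
    proof (cases "t b = 0")
      case False
      have "comb J t = - (t b *s comb J (\<lambda>x. - (t x / t b)))"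
        using False by (simp add: comb_scale[symmetric]) (simp add: comb_def sum_negf)
      then have "comb (insert b J) t = t b *s (b - comb J (\<lambda>x. - (t x / t b)))"
        by (simp add: eq scale_right_diff_distrib)
      moreover have "b - comb J (\<lambda>x. - (t x / t b)) \<in> S"
        using b comb_in[OF J(2)] subspace_diff[OF subspace_S] by blast
      ultimately have "?n = norm (t b) * N (b - comb J (\<lambda>x. - (t x / t b)))"
        by (simp add: N_scale)
      then show ?thesis using mult_right_mono[OF d(2) norm_ge_zero[of "t b"], of "\<lambda>x. - (t x / t b)"]
        by (simp add: mult.commute)
    qed (use n0 in simp)
    show ?thesis
    proof (cases "x = b")
      case True
      have "c' * norm (t b) \<le> d * norm (t b)" by (intro mult_right_mono) (auto simp: c'_def)
      then show ?thesis using tb True by simp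
    next
      case False
      then have "c * norm (t x) \<le> N (comb J t)" using x st by (auto simp: stably_independent_def)
      also have "comb J t = comb (insert b J) t - t b *s b" by (simp add: eq)
      also have "N \<dots> \<le> ?n + norm (t b) * N b"
        using triangle_diff[of "comb (insert b J) t" "t b *s b"] J b N_scale[of b]
          subspace_scale[OF subspace_S] comb_in[of "insert b J"] by simp
      also have "norm (t b) * N b \<le> ?n / d * N b"
        using tb d by (intro mult_right_mono Nb) (simp add: field_simps)
      finally have *: "c * norm (t x) \<le> ?n * (1 + N b / d)" by (simp add: algebra_simps)
      have p: "1 + N b / d > 0" using Nb d by (auto intro!: add_pos_nonneg)
      have "c' * norm (t x) \<le> c / (1 + N b / d) * norm (t x)"
        by (intro mult_right_mono) (auto simp: c'_def)
      also have "\<dots> \<le> ?n" using * p by (simp add: field_simps)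
      finally show ?thesis .
    qed
  qed
  then show ?thesis using c' by (auto simp: stably_independent_def)
qed

text \<open>
  Vectors are added one at a time. By closedness, a new vector either has positive distance from the
  combinations of the old ones or agrees with one of them modulo the null space.
\<close>

lemma stably_independent_subset_exists:
  assumes "finite B" "B \<subseteq> S"
  shows "\<exists>J c. J \<subseteq> B \<and> stably_independent c J \<and> (\<forall>b\<in>B. \<exists>t. N (b - comb J t) = 0)"
  using assms
proof (induction B rule: finite_induct)
  case empty
  show ?case by (intro exI[of _ "{}"] exI[of _ 1]) (simp add: stably_independent_def)
next
  case (insert b B)
  then obtain J c where J: "J \<subseteq> B" "stably_independent c J" "\<forall>b\<in>B. \<exists>t. N (b - comb J t) = 0" by auto
  have fJ: "finite J" "J \<subseteq> S" using J insert finite_subset by auto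
  show ?case
  proof (cases "\<forall>e>0. \<exists>t. N (b - comb J t) < e")
    case True
    then have "\<exists>t. N (b - comb J t) = 0"
      using stably_independent_closed[OF fJ J(2), of b] insert by auto
    then show ?thesis using J by (intro exI[of _ J] exI[of _ c]) auto
  next
    case False
    then obtain d where d: "d > 0" "\<And>t. d \<le> N (b - comb J t)" by (force simp: not_less)
    have bJ: "b \<notin> J" using J insert by auto
    obtain c' where c': "stably_independent c' (insert b J)"
      using stably_independent_insert[OF fJ J(2) _ bJ d] insert by auto
    have "\<exists>t. N (x - comb (insert b J) t) = 0" if x: "x \<in> insert b B" for x
    proof (cases "x = b")
      case True
      have "comb J (\<lambda>x. if x = b then 1 else 0) = 0"
        unfolding comb_def by (intro sum.neutral) (use bJ in auto)
      then have "comb (insert b J) (\<lambda>x. if x = b then 1 else 0) = b"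
        using fJ bJ by (simp add: comb_def)
      then show ?thesis using True N_zero by (metis diff_self)
    next
      case False
      then obtain t where t: "N (x - comb J t) = 0" using x J by auto
      have "comb (insert b J) (t(b := 0)) = comb J t"
        using fJ bJ by (simp add: comb_def) (intro sum.cong, auto)
      then show ?thesis using t by metis
    qed
    then show ?thesis using J c' by (intro exI[of _ "insert b J"] exI[of _ c']) auto
  qed
qed

lemma subspace_comb_classes:
  assumes J: "J \<subseteq> S"
  shows "subspace {x \<in> S. \<exists>t. N (x - comb J t) = 0}"
proof (rule subspaceI)
  have "comb J (\<lambda>_. 0) = 0" by (simp add: comb_def)
  then show "0 \<in> {x \<in> S. \<exists>t. N (x - comb J t) = 0}"
    using subspace_0[OF subspace_S] N_zero by (auto intro!: exI[of _ "\<lambda>_. 0"])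
next
  fix x y assume "x \<in> {x \<in> S. \<exists>t. N (x - comb J t) = 0}" "y \<in> {x \<in> S. \<exists>t. N (x - comb J t) = 0}"
  then obtain s t where *: "x \<in> S" "y \<in> S" "N (x - comb J s) = 0" "N (y - comb J t) = 0" by auto
  have inS: "u - comb J r \<in> S" if "u \<in> S" for u r
    using that comb_in[OF J] subspace_diff[OF subspace_S] by blast
  have eq: "x + y - comb J (\<lambda>b. s b + t b) = (x - comb J s) + (y - comb J t)" by (simp add: comb_add)
  have "N (x + y - comb J (\<lambda>b. s b + t b)) \<le> 0"
    unfolding eq using triangle[OF inS inS, of x y s t] * by simp
  moreover have "x + y \<in> S" using * subspace_add[OF subspace_S] by blast
  ultimately show "x + y \<in> {x \<in> S. \<exists>t. N (x - comb J t) = 0}"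
    using N_nonneg[OF inS, of "x + y"] by (auto intro!: exI[of _ "\<lambda>b. s b + t b"] antisym)
next
  fix c x assume "x \<in> {x \<in> S. \<exists>t. N (x - comb J t) = 0}"
  then obtain t where *: "x \<in> S" "N (x - comb J t) = 0" by auto
  have "c *s x - comb J (\<lambda>b. c * t b) = c *s (x - comb J t)"
    by (simp add: comb_scale scale_right_diff_distrib)
  moreover have "x - comb J t \<in> S" using * comb_in[OF J] subspace_diff[OF subspace_S] by blast
  ultimately have "N (c *s x - comb J (\<lambda>b. c * t b)) = 0" using * by (simp add: N_scale)
  then show "c *s x \<in> {x \<in> S. \<exists>t. N (x - comb J t) = 0}"
    using * subspace_scale[OF subspace_S] by blast
qed

lemma span_comb_classes:
  assumes "finite B" "B \<subseteq> S"
  shows "\<exists>J c. J \<subseteq> B \<and> stably_independent c J \<and> (\<forall>x\<in>span B. \<exists>t. N (x - comb J t) = 0)"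
proof -
  obtain J c where J: "J \<subseteq> B" "stably_independent c J" "\<forall>b\<in>B. \<exists>t. N (b - comb J t) = 0"
    using stably_independent_subset_exists[OF assms] by blast
  have "span B \<subseteq> {x \<in> S. \<exists>t. N (x - comb J t) = 0}"
    using J assms by (intro span_minimal subspace_comb_classes) auto
  then show ?thesis using J by blast
qed

end


section \<open>Hahn--Banach extension over the scalar field\<close>

text \<open>
  Partial functionals are given by their graphs, which are subspaces of the product with the reals.
  The bound \<open>r \<le> C * norm x\<close> on all points of such a subspace already forces it to be a graph, since it
  applies to \<open>(0, r)\<close> and \<open>(0, - r)\<close>. The value at \<open>x0\<close> has to lie between a supremum and an infimum,
  and the triangle inequality orders these correctly.
\<close>

lemma hahn_banach_step:
  fixes G :: "('v::real_normed_vector \<times> real) set"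
  assumes G: "subspace G" and le: "\<And>x r. (x, r) \<in> G \<Longrightarrow> r \<le> C * norm x" and C: "C \<ge> 0"
  shows "\<exists>r0. \<forall>x r t. (x, r) \<in> G \<longrightarrow> r + t * r0 \<le> C * norm (x + t *\<^sub>R x0)"
proof -
  define L where "L = (\<lambda>(x, r). r - C * norm (x - x0)) ` G"
  have key: "r - C * norm (x - x0) \<le> C * norm (y + x0) - s" if "(x, r) \<in> G" "(y, s) \<in> G" for x r y s
  proof -
    have "(x + y, r + s) \<in> G" using subspace_add[OF G that] by simp
    then have *: "r + s \<le> C * norm (x + y)" by (rule le)
    have "norm (x + y) \<le> norm (x - x0) + norm (y + x0)"
      using norm_triangle_ineq[of "x - x0" "y + x0"] by simp
    then have "C * norm (x + y) \<le> C * (norm (x - x0) + norm (y + x0))" using C by (rule mult_left_mono)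
    then show ?thesis using * by (simp add: algebra_simps)
  qed
  have zero: "(0, 0) \<in> G" using subspace_0[OF G] by (simp add: zero_prod_def)
  have bdd: "bdd_above L" using key[OF _ zero] by (intro bdd_aboveI[of _ "C * norm x0"]) (auto simp: L_def)
  have ne: "L \<noteq> {}" using zero by (auto simp: L_def)
  define r0 where "r0 = Sup L"
  have lo: "r - C * norm (x - x0) \<le> r0" if "(x, r) \<in> G" for x r
    unfolding r0_def by (rule cSup_upper[OF _ bdd]) (unfold L_def, rule image_eqI[of _ _ "(x, r)"], use that in auto)
  have up: "r0 \<le> C * norm (y + x0) - s" if "(y, s) \<in> G" for y s
    unfolding r0_def by (rule cSup_least[OF ne]) (use key[OF _ that] in \<open>auto simp: L_def\<close>)
  have "r + t * r0 \<le> C * norm (x + t *\<^sub>R x0)" if xr: "(x, r) \<in> G" for x r t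
  proof -
    have sc: "(u *\<^sub>R x, u * r) \<in> G" for u using subspace_scale[OF G xr, of u] by simp
    consider "t = 0" | "t > 0" | "t < 0" by linarith
    then show ?thesis
    proof cases
      case 1
      then show ?thesis using le[OF xr] by simp
    next
      case 2
      have "x + t *\<^sub>R x0 = t *\<^sub>R (inverse t *\<^sub>R x + x0)" using 2 by (simp add: algebra_simps)
      then have "norm (x + t *\<^sub>R x0) = t * norm (inverse t *\<^sub>R x + x0)" using 2 by simp
      moreover have "t * (r0 + inverse t * r) \<le> t * (C * norm (inverse t *\<^sub>R x + x0))"
        using up[OF sc[of "inverse t"]] 2 by (intro mult_left_mono) auto
      ultimately show ?thesis using 2 by (simp add: algebra_simps)
    next
      case 3
      have "x + t *\<^sub>R x0 = (- t) *\<^sub>R (inverse (- t) *\<^sub>R x - x0)" using 3 by (simp add: algebra_simps)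
      then have "norm (x + t *\<^sub>R x0) = (- t) * norm (inverse (- t) *\<^sub>R x - x0)"
        using 3 by (metis abs_of_pos neg_0_less_iff_less norm_scaleR)
      moreover have "(- t) * (inverse (- t) * r) \<le> (- t) * (r0 + C * norm (inverse (- t) *\<^sub>R x - x0))"
        using lo[OF sc[of "inverse (- t)"]] 3 by (intro mult_left_mono) linarith+
      moreover have "(- t) * (inverse (- t) * r) = r" using 3 by simp
      ultimately show ?thesis by (simp only: distrib_left) (simp add: mult_ac)
    qed
  qed
  then show ?thesis by blast
qed

lemma real_hahn_banach:
  fixes G :: "('v::real_normed_vector \<times> real) set"
  assumes G: "subspace G" and le: "\<And>x r. (x, r) \<in> G \<Longrightarrow> r \<le> C * norm x" and C: "C \<ge> 0"
  shows "\<exists>g. linear g \<and> (\<forall>x. \<bar>g x\<bar> \<le> C * norm x) \<and> (\<forall>(x, r)\<in>G. g x = r)"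
proof -
  define P where "P = {H. subspace H \<and> (\<forall>(x, r)\<in>H. r \<le> C * norm x) \<and> G \<subseteq> H}"
  have "\<exists>H\<in>P. \<forall>K\<in>P. H \<subseteq> K \<longrightarrow> K = H"
  proof (rule subset_Zorn_nonempty)
    show "P \<noteq> {}" using assms by (auto simp: P_def)
  next
    fix \<C> assume ne: "\<C> \<noteq> {}" and ch: "subset.chain P \<C>"
    have CP: "\<And>H. H \<in> \<C> \<Longrightarrow> H \<in> P" using ch by (auto simp: subset.chain_def)
    have "subspace (\<Union>\<C>)"
    proof (rule subspaceI)
      show "0 \<in> \<Union>\<C>" using ne CP by (force simp: P_def dest: subspace_0)
    next
      fix p q assume "p \<in> \<Union>\<C>" "q \<in> \<Union>\<C>"
      then obtain H K where HK: "H \<in> \<C>" "K \<in> \<C>" "p \<in> H" "q \<in> K" by blast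
      then have "H \<subseteq> K \<or> K \<subseteq> H" using ch by (auto simp: subset_chain_def)
      then obtain M where "M \<in> \<C>" "p \<in> M" "q \<in> M" using HK by blast
      then show "p + q \<in> \<Union>\<C>" using CP[of M] by (auto simp: P_def intro: subspace_add)
    next
      fix p :: "'v \<times> real" and c :: real assume "p \<in> \<Union>\<C>"
      then show "c *\<^sub>R p \<in> \<Union>\<C>" using CP by (auto simp: P_def intro: subspace_scale)
    qed
    then show "\<Union>\<C> \<in> P" using CP ne by (auto simp: P_def)
  qed
  then obtain H where H: "H \<in> P" and max: "\<And>K. K \<in> P \<Longrightarrow> H \<subseteq> K \<Longrightarrow> K = H" by blast
  have sH: "subspace H" and leH: "\<And>x r. (x, r) \<in> H \<Longrightarrow> r \<le> C * norm x" and GH: "G \<subseteq> H"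
    using H by (auto simp: P_def)
  have uniq: "r = s" if "(x, r) \<in> H" "(x, s) \<in> H" for x r s
    using leH[of 0 "r - s"] leH[of 0 "s - r"] subspace_diff[OF sH that] subspace_diff[OF sH that(2,1)]
    by simp
  have total: "\<exists>r. (x0, r) \<in> H" for x0
  proof -
    obtain r0 where r0: "\<And>x r t. (x, r) \<in> H \<Longrightarrow> r + t * r0 \<le> C * norm (x + t *\<^sub>R x0)"
      using hahn_banach_step[OF sH leH C, of x0] by blast
    let ?K = "{p + q | p q. p \<in> H \<and> q \<in> span {(x0, r0)}}"
    have HK: "H \<subseteq> ?K"
    proof
      fix p assume "p \<in> H"
      then show "p \<in> ?K" using span_0[of "{(x0, r0)}"] by (intro CollectI exI[of _ p] exI[of _ 0]) simp
    qed
    have "?K \<in> P"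
      unfolding P_def
    proof (intro CollectI conjI ballI)
      show "subspace ?K" by (rule subspace_sums[OF sH subspace_span])
      show "G \<subseteq> ?K" using GH HK by blast
      show "case p of (x, r) \<Rightarrow> r \<le> C * norm x" if "p \<in> ?K" for p
        using that r0 by (auto simp: span_singleton)
    qed
    then have "?K = H" using HK by (rule max)
    moreover have "(x0, r0) \<in> ?K"
      using subspace_0[OF sH] span_base[of "(x0, r0)" "{(x0, r0)}"]
      by (intro CollectI exI[of _ 0] exI[of _ "(x0, r0)"]) simp
    ultimately show ?thesis by blast
  qed
  define g where "g x = (THE r. (x, r) \<in> H)" for x
  have g: "(x, g x) \<in> H" for x
    unfolding g_def using total[of x] uniq by (metis theI)
  have geq: "g x = r" if "(x, r) \<in> H" for x r using uniq[OF g that] .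
  have "linear g"
    by (rule linearI)
      (use geq subspace_add[OF sH g g] subspace_scale[OF sH g] in auto)
  moreover have "\<bar>g x\<bar> \<le> C * norm x" for x
    using leH[OF g[of x]] leH[of "- x" "- g x"] subspace_neg[OF sH g[of x]] by auto
  ultimately show ?thesis using geq GH by blast
qed

definition bounded_functional ::
  "('k::real_normed_field \<Rightarrow> 'v::real_normed_vector \<Rightarrow> 'v) \<Rightarrow> real \<Rightarrow> ('v \<Rightarrow> 'k) \<Rightarrow> bool" where
  "bounded_functional smul C f \<longleftrightarrow>
     (\<forall>x y. f (x + y) = f x + f y) \<and> (\<forall>c x. f (smul c x) = c * f x) \<and> (\<forall>x. norm (f x) \<le> C * norm x)"

lemma cball_finite_cover:
  fixes a :: "'a::heine_borel"
  assumes e: "e > 0"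
  obtains F where "finite F" "cball a r \<subseteq> (\<Union>p\<in>F. ball p e)"
proof (rule compactE_image[OF compact_cball[of a r], of "cball a r" "\<lambda>p. ball p e"])
  show "cball a r \<subseteq> (\<Union>p\<in>cball a r. ball p e)"
    using centre_in_ball e by blast
qed (use that in blast)+

text \<open>
  Riesz's argument: the unit ball is totally bounded, so the span of a finite set \<open>F\<close> that is
  \<open>1/2\<close>-dense in it is dense, and it is closed.
\<close>

lemma scalar_field_basis:
  obtains J :: "'k::{real_normed_field,heine_borel} set" and c
  where "finite J" "c > 0" "\<And>t b. b \<in> J \<Longrightarrow> c * \<bar>t b\<bar> \<le> norm (\<Sum>b\<in>J. t b *\<^sub>R b)"
    "\<And>x. \<exists>t. x = (\<Sum>b\<in>J. t b *\<^sub>R b)"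
proof -
  interpret K: seminormed_space "scaleR :: real \<Rightarrow> 'k \<Rightarrow> 'k" UNIV norm
    by (intro seminormed_space.intro seminormed_space_axioms.intro real_vector.vector_space_axioms
        module.subspace_UNIV[OF real_vector.module_axioms] norm_triangle_ineq) simp
  obtain F where F: "finite F" "cball (0::'k) 1 \<subseteq> (\<Union>x\<in>F. ball x (1/2))"
    using cball_finite_cover[of "1/2" "0::'k" 1] by auto
  obtain J c where J: "J \<subseteq> F" "K.stably_independent c J" "\<And>x. x \<in> span F \<Longrightarrow> \<exists>t. norm (x - K.comb J t) = 0"
    using K.span_comb_classes[OF F(1) subset_UNIV, folded span_raw_def] by blast
  have fJ: "finite J" using J F finite_subset by blast
  have "\<exists>t. norm (x - K.comb J t) = 0" for x
  proof (rule K.stably_independent_closed[OF fJ _ J(2)])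
    fix e :: real assume e: "e > 0"
    show "\<exists>t. norm (x - K.comb J t) < e"
    proof (rule ccontr)
      assume "\<not> ?thesis"
      then have far: "e \<le> norm (x - w)" if "w \<in> span F" for w
        using J(3)[OF that] by (auto simp: not_less)
      define d where "d = (INF w\<in>span F. norm (x - w))"
      have bdd: "bdd_below ((\<lambda>w. norm (x - w)) ` span F)" by (rule bdd_belowI[of _ 0]) auto
      have ne: "span F \<noteq> {}" using span_0 by blast
      have "e \<le> d" unfolding d_def using far ne by (intro cINF_greatest) auto
      then have d: "d > 0" using e by simp
      then have "d < 2 * d" by simp
      then obtain w where w: "w \<in> span F" "norm (x - w) < 2 * d"
        using cINF_less_iff[OF ne bdd] unfolding d_def by blast
      let ?r = "norm (x - w)"
      have r: "?r > 0" using order.strict_trans2[OF e far[OF w(1)]] .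
      have "(x - w) /\<^sub>R ?r \<in> cball 0 1" using r by simp
      then have "(x - w) /\<^sub>R ?r \<in> (\<Union>f\<in>F. ball f (1/2))" using F(2) by blast
      then obtain f where f: "f \<in> F" "norm (f - (x - w) /\<^sub>R ?r) < 1 / 2"
        by (auto simp: dist_norm)
      have "w + ?r *\<^sub>R f \<in> span F" by (intro span_add span_scale span_base w f)
      then have "d \<le> norm (x - (w + ?r *\<^sub>R f))" unfolding d_def by (rule cINF_lower[OF bdd])
      also have "x - (w + ?r *\<^sub>R f) = - (?r *\<^sub>R (f - (x - w) /\<^sub>R ?r))"
        using r by (simp add: algebra_simps)
      also have "norm \<dots> < ?r * (1 / 2)" using f r by simp
      finally show False using w by simp
    qed
  qed auto
  then have "\<exists>t. x = (\<Sum>b\<in>J. t b *\<^sub>R b)" for x by (simp add: K.comb_def)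
  moreover have "c > 0" "\<And>t b. b \<in> J \<Longrightarrow> c * \<bar>t b\<bar> \<le> norm (\<Sum>b\<in>J. t b *\<^sub>R b)"
    using J(2) by (auto simp: K.stably_independent_def K.comb_def)
  ultimately show thesis using fJ that by blast
qed

text \<open>
  Any nonzero real functional \<open>\<tau>\<close> on the field, here a coordinate, makes \<open>(x, y) \<mapsto> \<tau> (x * y)\<close> a
  nondegenerate form, so a real basis has a dual basis. This plays the role that real parts play in the
  passage from real to complex functionals, without classifying the field.
\<close>

lemma scalar_field_trace:
  obtains J :: "'k::{real_normed_field,heine_borel} set" and \<tau> :: "'k \<Rightarrow> real" and C y
  where "finite J" "span J = UNIV" "linear \<tau>" "C \<ge> 0" "\<And>x. \<bar>\<tau> x\<bar> \<le> C * norm x"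
    "\<And>x. (\<And>k. \<tau> (k * x) = 0) \<Longrightarrow> x = 0"
    "\<And>a b. a \<in> J \<Longrightarrow> b \<in> J \<Longrightarrow> \<tau> (a * y b) = (if a = b then 1 else 0)"
proof -
  obtain J :: "'k set" and c where J: "finite J" "c > 0"
    "\<And>t b. b \<in> J \<Longrightarrow> c * \<bar>t b\<bar> \<le> norm (\<Sum>b\<in>J. t b *\<^sub>R b)" "\<And>x. \<exists>t. x = (\<Sum>b\<in>J. t b *\<^sub>R b)"
    by (rule scalar_field_basis) auto
  obtain r where r: "\<And>x. (\<Sum>b\<in>J. r x b *\<^sub>R b) = x" using J(4) by metis
  have uniq: "s b = t b" if "b \<in> J" "(\<Sum>b\<in>J. s b *\<^sub>R b) = (\<Sum>b\<in>J. t b *\<^sub>R b)" for s t :: "'k \<Rightarrow> real" and b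
    using J(3)[OF that(1), of "\<lambda>b. s b - t b"] that(2) J(2)
    by (simp add: scaleR_left_diff_distrib sum_subtractf mult_le_0_iff)
  have span: "span J = UNIV"
  proof -
    have "x \<in> span J" for x
    proof -
      have "(\<Sum>b\<in>J. r x b *\<^sub>R b) \<in> span J" by (intro span_sum span_scale span_base)
      then show ?thesis by (simp only: r)
    qed
    then show ?thesis by blast
  qed
  have indep: "independent J"
    unfolding dependent_finite[OF J(1)] using uniq[of _ _ "\<lambda>_. 0"] by auto
  have "J \<noteq> {}"
  proof
    assume "J = {}"
    then show False using r[of 1] by simp
  qed
  then obtain b0 where b0: "b0 \<in> J" by blast
  define \<tau> where "\<tau> x = r x b0" for x
  have lin: "linear \<tau>"
  proof (rule linearI)
    fix x y
    have "(\<Sum>b\<in>J. r (x + y) b *\<^sub>R b) = (\<Sum>b\<in>J. (r x b + r y b) *\<^sub>R b)"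
      by (simp add: r scaleR_left_distrib sum.distrib)
    then show "\<tau> (x + y) = \<tau> x + \<tau> y" unfolding \<tau>_def by (rule uniq[OF b0])
  next
    fix c x
    have "(\<Sum>b\<in>J. r (c *\<^sub>R x) b *\<^sub>R b) = (\<Sum>b\<in>J. (c * r x b) *\<^sub>R b)"
      by (simp add: r scaleR_scaleR[symmetric] scaleR_sum_right[symmetric] del: scaleR_scaleR)
    then show "\<tau> (c *\<^sub>R x) = c *\<^sub>R \<tau> x" unfolding \<tau>_def using uniq[OF b0] by auto
  qed
  have bnd: "\<bar>\<tau> x\<bar> \<le> inverse c * norm x" for x
    using J(3)[OF b0, of "r x"] J(2) by (simp add: r \<tau>_def field_simps)
  have b0_1: "\<tau> b0 = 1"
  proof -
    have "(\<Sum>b\<in>J. r b0 b *\<^sub>R b) = (\<Sum>b\<in>J. (if b = b0 then 1 else 0) *\<^sub>R b)"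
      using J(1) b0 by (simp add: r if_distrib[of "\<lambda>c. c *\<^sub>R _"] cong: if_cong)
    from uniq[OF b0 this] show ?thesis by (simp add: \<tau>_def)
  qed
  have nondeg: "x = 0" if "\<And>k. \<tau> (k * x) = 0" for x
  proof (rule ccontr)
    assume "x \<noteq> 0"
    then show False using that[of "b0 / x"] b0_1 by simp
  qed
  define \<Theta> where "\<Theta> x = (\<Sum>b\<in>J. \<tau> (b * x) *\<^sub>R b)" for x
  have lin_mult: "linear (\<lambda>k. \<tau> (k * x))" for x
    using linear_compose[OF bounded_linear.linear[OF bounded_linear_mult_left] lin] by (simp add: o_def)
  have lin_mult': "linear (\<lambda>k. \<tau> (x * k))" for x
    using linear_compose[OF bounded_linear.linear[OF bounded_linear_mult_right] lin] by (simp add: o_def)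
  have lin\<Theta>: "linear \<Theta>"
    unfolding \<Theta>_def
    by (intro linear_compose_sum ballI linearI)
      (simp_all add: linear_add[OF lin_mult'] linear_scale[OF lin] linear_scale[OF lin_mult'] scaleR_left_distrib)
  have "inj \<Theta>"
    unfolding linear_injective_0[OF lin\<Theta>]
  proof (intro allI impI)
    fix x assume "\<Theta> x = 0"
    then have z: "\<tau> (b * x) = 0" if "b \<in> J" for b
      using uniq[OF that, of "\<lambda>b. \<tau> (b * x)" "\<lambda>_. 0"] by (simp add: \<Theta>_def)
    have "\<tau> (k * x) = 0" for k
      by (rule linear_eq_0_on_span[OF lin_mult z, of J]) (simp_all add: span)
    then show "x = 0" by (rule nondeg)
  qed
  interpret fd: finite_dimensional_vector_space "scaleR :: real \<Rightarrow> 'k \<Rightarrow> 'k" J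
    using J(1) indep span by unfold_locales (auto simp: dependent_raw_def span_raw_def)
  have "surj \<Theta>"
    using fd.linear_inj_imp_surj[OF lin\<Theta>[unfolded linear_def] \<open>inj \<Theta>\<close>] .
  then have "\<exists>x. \<Theta> x = b" for b by (metis surjD)
  then obtain y where y: "\<And>b. \<Theta> (y b) = b" by metis
  have "\<tau> (a * y b) = (if a = b then 1 else 0)" if "a \<in> J" "b \<in> J" for a b
  proof -
    have "(\<Sum>a\<in>J. \<tau> (a * y b) *\<^sub>R a) = (\<Sum>a\<in>J. (if a = b then 1 else 0) *\<^sub>R a)"
      using y[of b] that J(1) by (simp add: \<Theta>_def if_distrib[of "\<lambda>c. c *\<^sub>R _"] cong: if_cong)
    from uniq[OF that(1) this] show ?thesis .
  qed
  moreover have "inverse c \<ge> 0" using J(2) by simp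
  ultimately show thesis by (intro that[OF J(1) span lin _ bnd nondeg])
qed

text \<open>
  Composition with \<open>\<tau>\<close> reduces the extension problem to the real Hahn--Banach theorem, and the dual
  basis recovers a \<open>'k\<close>-linear functional \<open>f\<close> with \<open>\<tau> (k * f v) = g (smul k v)\<close>. The constant
  \<open>\<kappa>\<close> depends on the norms of the two bases only. The hypothesis is Helly's condition, which makes
  the prescribed values well defined and bounded.
\<close>

lemma helly_extension:
  fixes smul :: "'k::{real_normed_field,heine_borel} \<Rightarrow> 'v::real_normed_vector \<Rightarrow> 'v"
  assumes "normed_space_over smul"
  obtains \<kappa> where "\<kappa> > 0" "\<And>(J :: 'j set) y \<alpha> C. finite J \<Longrightarrow> C \<ge> 0 \<Longrightarrow>
     (\<And>s. norm (\<Sum>j\<in>J. s j * \<alpha> j) \<le> C * norm (\<Sum>j\<in>J. smul (s j) (y j))) \<Longrightarrow>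
     \<exists>f. bounded_functional smul (\<kappa> * C) f \<and> (\<forall>j\<in>J. f (y j) = \<alpha> j)"
proof -
  interpret V: normed_space_over smul by fact
  obtain B :: "'k set" and \<tau> C\<tau> z where B: "finite B" "span B = UNIV" and lin: "linear \<tau>"
    and C\<tau>: "C\<tau> \<ge> 0" "\<And>x. \<bar>\<tau> x\<bar> \<le> C\<tau> * norm x" and nondeg: "\<And>x. (\<And>k. \<tau> (k * x) = 0) \<Longrightarrow> x = 0"
    and dual: "\<And>a b. a \<in> B \<Longrightarrow> b \<in> B \<Longrightarrow> \<tau> (a * z b) = (if a = b then 1 else 0)"
    by (rule scalar_field_trace) blast
  define \<kappa> where "\<kappa> = C\<tau> * (\<Sum>b\<in>B. norm b * norm (z b)) + 1"
  have \<kappa>: "\<kappa> > 0" unfolding \<kappa>_def using C\<tau> by (intro add_nonneg_pos mult_nonneg_nonneg sum_nonneg) auto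
  have "\<exists>f. bounded_functional smul (\<kappa> * C) f \<and> (\<forall>j\<in>J. f (y j) = \<alpha> j)"
    if J: "finite J" and C: "C \<ge> 0"
      and hyp: "\<And>s. norm (\<Sum>j\<in>J. s j * \<alpha> j) \<le> C * norm (\<Sum>j\<in>J. smul (s j) (y j))"
    for J :: "'j set" and y \<alpha> C
  proof -
    \<comment> \<open>The prescribed values, composed with \<open>\<tau>\<close>, form a bounded real graph.\<close>
    define G where "G = range (\<lambda>s. (\<Sum>j\<in>J. smul (s j) (y j), \<tau> (\<Sum>j\<in>J. s j * \<alpha> j)))"
    have smul_scaleR: "r *\<^sub>R smul k v = smul (r *\<^sub>R k) v" for r k v
      by (simp add: V.scale_of_real[symmetric] scaleR_conv_of_real)
    have "subspace G"
    proof (rule subspaceI)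
      show "0 \<in> G" unfolding G_def
        by (rule image_eqI[of _ _ "\<lambda>_. 0"]) (auto simp: zero_prod_def linear_0[OF lin])
    next
      fix p q assume "p \<in> G" "q \<in> G"
      then obtain s t where "p = (\<Sum>j\<in>J. smul (s j) (y j), \<tau> (\<Sum>j\<in>J. s j * \<alpha> j))"
        "q = (\<Sum>j\<in>J. smul (t j) (y j), \<tau> (\<Sum>j\<in>J. t j * \<alpha> j))" by (auto simp: G_def)
      then show "p + q \<in> G" unfolding G_def
        by (intro image_eqI[of _ _ "\<lambda>j. s j + t j"])
          (auto simp: V.scale_left_distrib sum.distrib distrib_right linear_add[OF lin])
    next
      fix p and c :: real assume "p \<in> G"
      then obtain s where "p = (\<Sum>j\<in>J. smul (s j) (y j), \<tau> (\<Sum>j\<in>J. s j * \<alpha> j))" by (auto simp: G_def)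
      then show "c *\<^sub>R p \<in> G" unfolding G_def
        by (intro image_eqI[of _ _ "\<lambda>j. c *\<^sub>R s j"])
          (simp_all add: linear_scale[OF lin, unfolded real_scaleR_def, symmetric] scaleR_sum_right smul_scaleR)
    qed
    moreover have "r \<le> C\<tau> * C * norm x" if xr: "(x, r) \<in> G" for x r
    proof -
      obtain s where s: "x = (\<Sum>j\<in>J. smul (s j) (y j))" "r = \<tau> (\<Sum>j\<in>J. s j * \<alpha> j)"
        using xr by (auto simp: G_def)
      have "r \<le> C\<tau> * norm (\<Sum>j\<in>J. s j * \<alpha> j)" using C\<tau>(2)[of "\<Sum>j\<in>J. s j * \<alpha> j"] s by simp
      also have "\<dots> \<le> C\<tau> * (C * norm x)" using hyp[of s] C\<tau>(1) s by (intro mult_left_mono) auto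
      finally show ?thesis by simp
    qed
    ultimately obtain g where g: "linear g" "\<And>x. \<bar>g x\<bar> \<le> C\<tau> * C * norm x" "\<And>x r. (x, r) \<in> G \<Longrightarrow> g x = r"
      using real_hahn_banach[of G "C\<tau> * C"] C C\<tau> by fastforce
    define f where "f v = (\<Sum>b\<in>B. g (smul b v) *\<^sub>R z b)" for v
    have smul_add: "smul (j + k) v = smul j v + smul k v" for j k v by (rule V.scale_left_distrib)
    have tau_f: "\<tau> (k * f v) = g (smul k v)" for k v
    proof (rule linear_eq_on_span[of "\<lambda>k. \<tau> (k * f v)" "\<lambda>k. g (smul k v)" B])
      show "linear (\<lambda>k. \<tau> (k * f v))"
        using linear_compose[OF bounded_linear.linear[OF bounded_linear_mult_left] lin] by (simp add: o_def)
      show "linear (\<lambda>k. g (smul k v))"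
        by (rule linearI)
          (simp_all add: smul_add linear_add[OF g(1)] smul_scaleR[symmetric] linear_scale[OF g(1)])
      show "k \<in> span B" using B by simp
      show "\<tau> (a * f v) = g (smul a v)" if a: "a \<in> B" for a
      proof -
        have "\<tau> (a * f v) = (\<Sum>b\<in>B. g (smul b v) * \<tau> (a * z b))"
          by (simp add: f_def sum_distrib_left linear_sum[OF lin] linear_scale[OF lin])
        also have "\<dots> = (\<Sum>b\<in>B. if b = a then g (smul a v) else 0)"
          using dual a by (intro sum.cong) auto
        finally show ?thesis using a B by simp
      qed
    qed
    have eqI: "u = w" if "\<And>k. \<tau> (k * u) = \<tau> (k * w)" for u w
      using nondeg[of "u - w"] that by (simp add: right_diff_distrib linear_diff[OF lin])
    have "f (x + y) = f x + f y" for x y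
      by (rule eqI) (simp add: tau_f distrib_left linear_add[OF lin] V.scale_right_distrib linear_add[OF g(1)])
    moreover have "f (smul c x) = c * f x" for c x
    proof (rule eqI)
      fix k
      have "\<tau> (k * (c * f x)) = \<tau> ((k * c) * f x)" by (simp add: mult.assoc)
      then show "\<tau> (k * f (smul c x)) = \<tau> (k * (c * f x))" by (simp only: tau_f V.scale_scale)
    qed
    moreover have "norm (f x) \<le> \<kappa> * C * norm x" for x
    proof -
      have "norm (f x) \<le> (\<Sum>b\<in>B. norm (g (smul b x) *\<^sub>R z b))" unfolding f_def by (rule norm_sum)
      also have "\<dots> \<le> (\<Sum>b\<in>B. C\<tau> * C * norm x * (norm b * norm (z b)))"
      proof (rule sum_mono)
        fix b
        have "norm (g (smul b x) *\<^sub>R z b) \<le> (C\<tau> * C * norm (smul b x)) * norm (z b)"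
          using g(2) by (simp add: mult_right_mono)
        then show "norm (g (smul b x) *\<^sub>R z b) \<le> C\<tau> * C * norm x * (norm b * norm (z b))"
          by (simp add: V.norm_scale mult_ac)
      qed
      also have "\<dots> = C\<tau> * (\<Sum>b\<in>B. norm b * norm (z b)) * (C * norm x)"
        by (simp add: sum_distrib_left mult_ac)
      also have "\<dots> \<le> \<kappa> * (C * norm x)" using C by (intro mult_right_mono) (auto simp: \<kappa>_def)
      finally show ?thesis by (simp add: mult.assoc)
    qed
    moreover have "f (y j) = \<alpha> j" if j: "j \<in> J" for j
    proof (rule eqI)
      fix k
      have "(\<Sum>i\<in>J. smul (if i = j then k else 0) (y i)) = (\<Sum>i\<in>J. if i = j then smul k (y j) else 0)"
        by (intro sum.cong) auto
      moreover have "(\<Sum>i\<in>J. (if i = j then k else 0) * \<alpha> i) = (\<Sum>i\<in>J. if i = j then k * \<alpha> j else 0)"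
        by (intro sum.cong) auto
      ultimately have "(smul k (y j), \<tau> (k * \<alpha> j)) \<in> G"
        unfolding G_def using j J by (intro image_eqI[of _ _ "\<lambda>i. if i = j then k else 0"]) auto
      then show "\<tau> (k * f (y j)) = \<tau> (k * \<alpha> j)" using g(3) tau_f by simp
    qed
    ultimately have "bounded_functional smul (\<kappa> * C) f \<and> (\<forall>j\<in>J. f (y j) = \<alpha> j)"
      by (auto simp: bounded_functional_def)
    then show ?thesis by blast
  qed
  then show thesis by (rule that[OF \<kappa>])
qed


section \<open>Ultrafilters\<close>

text \<open>
  An ultrafilter is a minimal proper filter, and the infimum of a chain of proper filters is proper.
\<close>

lemma ultrafilter_le_exists:
  assumes F: "F \<noteq> bot"
  shows "\<exists>U\<le>F. ultrafilter U"
proof -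
  define A where "A = {G. G \<noteq> bot \<and> G \<le> F}"
  have "\<exists>m\<in>A. \<forall>a\<in>A. a \<le> m \<longrightarrow> a = m"
  proof (rule predicate_Zorn)
    show "partial_order_on A (relation_of (\<lambda>x y. y \<le> x) A)"
      by (rule partial_order_on_relation_ofI) auto
  next
    fix C assume C: "C \<in> Chains (relation_of (\<lambda>x y. y \<le> x) A)"
    show "\<exists>u\<in>A. \<forall>a\<in>C. u \<le> a"
    proof (cases "C = {}")
      case True
      then show ?thesis using F by (auto simp: A_def)
    next
      case False
      have CA: "C \<subseteq> A" using C by (auto simp: Chains_def relation_of_def)
      have "\<exists>x\<in>C. x \<le> inf G H" if "G \<in> C" "H \<in> C" for G H
      proof -
        have "G \<le> H \<or> H \<le> G" using C that by (auto simp: Chains_def relation_of_def)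
        then show ?thesis using that by (auto intro: bexI[of _ G] bexI[of _ H])
      qed
      then have ev: "eventually P (Inf C) \<longleftrightarrow> (\<exists>G\<in>C. eventually P G)" for P
        by (rule eventually_Inf_base[OF False])
      have "Inf C \<noteq> bot"
        using ev[of "\<lambda>_. False"] CA by (auto simp: A_def trivial_limit_def)
      moreover have "Inf C \<le> F" using False CA by (auto simp: A_def intro: Inf_lower2)
      ultimately show ?thesis by (intro bexI[of _ "Inf C"]) (auto simp: A_def intro: Inf_lower)
    qed
  qed
  then obtain U where U: "U \<noteq> bot" "U \<le> F" and max: "\<And>G. G \<noteq> bot \<Longrightarrow> G \<le> F \<Longrightarrow> G \<le> U \<Longrightarrow> G = U"
    by (auto simp: A_def)
  have "eventually P U \<or> eventually (\<lambda>i. \<not> P i) U" for P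
  proof (rule disjCI)
    assume no: "\<not> eventually (\<lambda>i. \<not> P i) U"
    let ?G = "inf U (principal {i. P i})"
    have "?G \<noteq> bot" using no by (auto simp: trivial_limit_def eventually_inf_principal)
    then have "?G = U" using U by (intro max) (auto intro: le_infI1)
    moreover have "eventually P ?G" by (simp add: eventually_inf_principal)
    ultimately show "eventually P U" by simp
  qed
  then show ?thesis using U by (auto simp: ultrafilter_def)
qed

text \<open>
  The map \<open>h\<close> regards a sequence of vectors as a family over the given index type, in such a
  way that the ultrafilter only sees the behaviour of the sequence at infinity.
\<close>

lemma ultrafilter_at_top_exists:
  assumes "infinite (UNIV :: 'i set)"
  shows "\<exists>(U :: 'i filter) (h :: 'i \<Rightarrow> nat). ultrafilter U \<and> filterlim h at_top U"
proof -
  obtain g :: "nat \<Rightarrow> 'i" where g: "inj g" using infinite_countable_subset[OF assms] by blast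
  have "filtermap g sequentially \<noteq> bot" by (simp add: filtermap_bot_iff)
  then obtain U where U: "U \<le> filtermap g sequentially" "ultrafilter U"
    using ultrafilter_le_exists by blast
  have "filterlim (inv g) at_top (filtermap g sequentially)"
    using g by (simp add: filterlim_filtermap filterlim_ident)
  then show ?thesis using U filterlim_mono[OF _ order_refl U(1)] by blast
qed

text \<open>
  An ultrafilter on a compact set converges to each of its cluster points.
\<close>

lemma ultrafilter_bounded_limit:
  fixes s :: "'i \<Rightarrow> 'k::heine_borel"
  assumes U: "ultrafilter U" and b: "bounded K" and ev: "eventually (\<lambda>i. s i \<in> K) U"
  shows "\<exists>l. (s \<longlongrightarrow> l) U"
proof -
  have c: "compact (closure K)" using b by (simp add: compact_closure)
  have nb: "filtermap s U \<noteq> bot" using U by (simp add: ultrafilter_def filtermap_bot_iff)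
  have "eventually (\<lambda>x. x \<in> closure K) (filtermap s U)"
    unfolding eventually_filtermap using ev closure_subset by (auto elim!: eventually_mono)
  then obtain l where l: "inf (nhds l) (filtermap s U) \<noteq> bot"
    using c nb unfolding compact_filter by blast
  have "eventually P (filtermap s U)" if P: "eventually P (nhds l)" for P
  proof (rule ccontr)
    assume "\<not> ?thesis"
    then have "eventually (\<lambda>x. \<not> P x) (filtermap s U)"
      using U by (auto simp: ultrafilter_def eventually_filtermap)
    then have "eventually (\<lambda>_. False) (inf (nhds l) (filtermap s U))"
      using P unfolding eventually_inf by blast
    then show False using l by (simp add: trivial_limit_def)
  qed
  then show ?thesis by (auto simp: filterlim_def le_filter_def)
qed


section \<open>Functionals and finite-rank operators on ultrapowers\<close>

abbreviation ultra_norm ::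
  "('k \<Rightarrow> 'v::real_normed_vector \<Rightarrow> 'v) \<Rightarrow> 'i filter \<Rightarrow> ('i \<Rightarrow> 'v) \<Rightarrow> real" where
  "ultra_norm smul U v \<equiv> nnorm (ultrapower smul U) (ultra_class U v)"

locale ultrapower_over = normed_space_over smul
  for smul :: "'k::{real_normed_field,heine_borel} \<Rightarrow> 'v::real_normed_vector \<Rightarrow> 'v" +
  fixes U :: "'i filter"
  assumes ultrafilter: "ultrafilter U"
begin

lemma nontrivial: "U \<noteq> bot"
  using ultrafilter by (simp add: ultrafilter_def)

lemma ultra_norm_tendsto: "v \<in> bounded_families \<Longrightarrow> ((\<lambda>i. norm (v i)) \<longlongrightarrow> ultra_norm smul U v) U"
  by (rule nnorm_ultra_class[OF _ ultrafilter])

lemma ultra_norm_eqI: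
  "v \<in> bounded_families \<Longrightarrow> ((\<lambda>i. norm (v i)) \<longlongrightarrow> l) U \<Longrightarrow> ultra_norm smul U v = l"
  using tendsto_unique[OF nontrivial ultra_norm_tendsto] by blast

sublocale F: seminormed_space "pointwise_scale smul" bounded_families "ultra_norm smul U"
proof -
  interpret W: vector_space "pointwise_scale smul :: 'k \<Rightarrow> ('i \<Rightarrow> 'v) \<Rightarrow> 'i \<Rightarrow> 'v" by (rule vector_space_pointwise)
  show "seminormed_space (pointwise_scale smul) bounded_families (ultra_norm smul U)"
  proof
    have "(0 :: 'i \<Rightarrow> 'v) \<in> bounded_families" by (auto simp: bounded_families_iff)
    then show "W.subspace bounded_families"
      by (intro W.subspaceI bounded_families_add bounded_families_scale)
  next
    fix x y :: "'i \<Rightarrow> 'v" assume *: "x \<in> bounded_families" "y \<in> bounded_families"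
    show "ultra_norm smul U (x + y) \<le> ultra_norm smul U x + ultra_norm smul U y"
      by (rule tendsto_le[OF nontrivial tendsto_add[OF ultra_norm_tendsto ultra_norm_tendsto] ultra_norm_tendsto])
        (use * in \<open>auto intro!: bounded_families_add always_eventually norm_triangle_ineq\<close>)
  next
    fix x :: "'i \<Rightarrow> 'v" and c assume *: "x \<in> bounded_families"
    show "ultra_norm smul U (pointwise_scale smul c x) = norm c * ultra_norm smul U x"
      using * by (intro ultra_norm_eqI bounded_families_scale)
        (auto simp: pointwise_scale_def norm_scale intro!: tendsto_mult_left ultra_norm_tendsto)
  qed
qed

lemma comb_apply: "F.comb J s n = (\<Sum>y\<in>J. smul (s y) (y n))"
proof -
  have "(sum g J) n = (\<Sum>y\<in>J. g y n)" for g :: "('i \<Rightarrow> 'v) \<Rightarrow> 'i \<Rightarrow> 'v"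
    by (induction J rule: infinite_finite_induct) auto
  then show ?thesis by (simp add: F.comb_def pointwise_scale_def)
qed

lemma ultra_class_eq_iff_norm:
  assumes "v \<in> bounded_families" "w \<in> bounded_families"
  shows "ultra_class U v = ultra_class U w \<longleftrightarrow> ultra_norm smul U (v - w) = 0"
proof -
  have "v - w \<in> bounded_families" by (rule bounded_families_diff[OF assms])
  then show ?thesis
    unfolding ultra_class_eq_iff[OF assms] null_families_def
    using ultra_norm_tendsto[of "v - w"] ultra_norm_eqI[of "v - w" 0] by auto
qed

text \<open>
  For each single \<open>s\<close> this is the definition of the norm of the ultrapower. If uniformity in \<open>s\<close> failed, the
  normalized counterexamples would have bounded coordinates, hence a limit along the ultrafilter, and
  the limit combination would have seminorm at least \<open>1\<close> and at most \<open>1/2\<close>.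
\<close>

lemma eventually_uniform_lower_bound:
  assumes J: "finite J" "J \<subseteq> bounded_families" and st: "F.stably_independent c J"
  shows "\<forall>\<^sub>F n in U. \<forall>s. ultra_norm smul U (F.comb J s) \<le> 2 * norm (F.comb J s n)"
proof (rule ccontr)
  assume "\<not> ?thesis"
  then have bad: "\<forall>\<^sub>F n in U. \<exists>s. 2 * norm (F.comb J s n) < ultra_norm smul U (F.comb J s)"
    using ultrafilter by (force simp: ultrafilter_def not_le)
  have c: "c > 0" using st by (simp add: F.stably_independent_def)
  have ex: "\<forall>\<^sub>F n in U. \<exists>s. ultra_norm smul U (F.comb J s) = 1 \<and> norm (F.comb J s n) < 1 / 2"
    using bad
  proof eventually_elim
    case (elim n)
    then obtain s where s: "2 * norm (F.comb J s n) < ultra_norm smul U (F.comb J s)" by blast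
    define r where "r = ultra_norm smul U (F.comb J s)"
    have r: "r > 0" using s norm_ge_zero[of "F.comb J s n"] unfolding r_def by linarith
    have eq: "F.comb J (\<lambda>y. of_real (inverse r) * s y) = pointwise_scale smul (of_real (inverse r)) (F.comb J s)"
      by (rule F.comb_scale)
    have "ultra_norm smul U (F.comb J (\<lambda>y. of_real (inverse r) * s y)) = 1"
      unfolding eq using r by (subst F.N_scale) (auto simp: F.comb_in[OF J(2)] r_def[symmetric] norm_inverse)
    moreover have "norm (F.comb J (\<lambda>y. of_real (inverse r) * s y) n) = inverse r * norm (F.comb J s n)"
      unfolding eq using r by (simp add: pointwise_scale_def norm_scale norm_inverse)
    moreover have "inverse r * norm (F.comb J s n) < 1 / 2"
      using s r by (simp add: r_def[symmetric] field_simps)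
    ultimately show ?case by metis
  qed
  obtain s where "\<And>n. (\<exists>s. ultra_norm smul U (F.comb J s) = 1 \<and> norm (F.comb J s n) < 1 / 2) \<Longrightarrow>
      ultra_norm smul U (F.comb J (s n)) = 1 \<and> norm (F.comb J (s n) n) < 1 / 2"
    using someI_ex[of "\<lambda>s. ultra_norm smul U (F.comb J s) = 1 \<and> norm (F.comb J s n) < 1 / 2" for n]
    by (rule that[rotated]) assumption
  with ex have s: "\<forall>\<^sub>F n in U. ultra_norm smul U (F.comb J (s n)) = 1 \<and> norm (F.comb J (s n) n) < 1 / 2"
    by (rule eventually_mono)
  have "\<exists>l. ((\<lambda>n. s n y) \<longlongrightarrow> l) U" if y: "y \<in> J" for y
  proof (rule ultrafilter_bounded_limit[OF ultrafilter bounded_cball])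
    show "\<forall>\<^sub>F n in U. s n y \<in> cball 0 (inverse c)"
      using s
    proof eventually_elim
      case (elim n)
      then show ?case using st y c by (auto simp: F.stably_independent_def field_simps dest!: spec[of _ "s n"])
    qed
  qed
  then obtain l where l: "\<And>y. y \<in> J \<Longrightarrow> ((\<lambda>n. s n y) \<longlongrightarrow> l y) U" by metis
  have small: "((\<lambda>n. \<Sum>y\<in>J. norm (s n y - l y) * K y) \<longlongrightarrow> 0) U" for K :: "('i \<Rightarrow> 'v) \<Rightarrow> real"
  proof -
    have "((\<lambda>n. \<Sum>y\<in>J. norm (s n y - l y) * K y) \<longlongrightarrow> (\<Sum>y\<in>J. norm (l y - l y) * K y)) U"
      by (intro tendsto_intros l)
    then show ?thesis by simp
  qed
  have "1 \<le> ultra_norm smul U (F.comb J l) + 0"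
  proof (rule tendsto_le[OF nontrivial tendsto_add[OF tendsto_const small] tendsto_const])
    show "\<forall>\<^sub>F n in U. 1 \<le> ultra_norm smul U (F.comb J l) + (\<Sum>y\<in>J. norm (s n y - l y) * ultra_norm smul U y)"
      using s
    proof eventually_elim
      case (elim n)
      have eq: "F.comb J (s n) = F.comb J l + F.comb J (\<lambda>y. s n y - l y)"
        unfolding F.comb_diff by (simp only: add_diff_eq add_diff_cancel_left')
      have "1 \<le> ultra_norm smul U (F.comb J l) + ultra_norm smul U (F.comb J (\<lambda>y. s n y - l y))"
        using F.triangle[OF F.comb_in F.comb_in, OF J(2) J(2), of l "\<lambda>y. s n y - l y"] elim
        unfolding eq[symmetric] by simp
      then show ?case using F.N_comb_le[OF J, of "\<lambda>y. s n y - l y"] by linarith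
    qed
  qed
  moreover have "\<forall>y\<in>J. \<exists>K. \<forall>n. norm (y n) \<le> K" using J by (auto simp: bounded_families_iff)
  then obtain K where K: "\<And>y n. y \<in> J \<Longrightarrow> norm (y n) \<le> K y" by metis
  have "ultra_norm smul U (F.comb J l) \<le> 1 / 2 + 0"
  proof (rule tendsto_le[OF nontrivial tendsto_add[OF tendsto_const small] ultra_norm_tendsto[OF F.comb_in[OF J(2)]]])
    show "\<forall>\<^sub>F n in U. norm (F.comb J l n) \<le> 1 / 2 + (\<Sum>y\<in>J. norm (s n y - l y) * K y)"
      using s
    proof eventually_elim
      case (elim n)
      have "norm (F.comb J (\<lambda>y. s n y - l y) n) \<le> (\<Sum>y\<in>J. norm (smul (s n y - l y) (y n)))"
        unfolding comb_apply by (rule norm_sum)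
      also have "\<dots> \<le> (\<Sum>y\<in>J. norm (s n y - l y) * K y)"
        by (intro sum_mono) (simp add: norm_scale mult_left_mono K)
      finally have "norm (F.comb J (\<lambda>y. s n y - l y) n) \<le> (\<Sum>y\<in>J. norm (s n y - l y) * K y)" .
      moreover have eq: "F.comb J l n = F.comb J (s n) n - F.comb J (\<lambda>y. s n y - l y) n"
        unfolding F.comb_diff by simp
      ultimately show ?case
        using elim norm_triangle_ineq4[of "F.comb J (s n) n" "F.comb J (\<lambda>y. s n y - l y) n", folded eq]
        by linarith
    qed
  qed
  ultimately show False by simp
qed

text \<open>
  The Helly condition says that \<open>\<phi>\<close> comes from a functional on the ultrapower of norm at most \<open>C\<close>. On a
  stably independent subset of \<open>Y\<close> the norms in the ultrapower are uniformly comparable with those of the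
  \<open>n\<close>-th components, so the values extend to a functional on the space itself. The
  remaining elements of \<open>Y\<close> agree with combinations of that subset only in the ultrapower, so their
  values are matched only approximately, for almost all \<open>n\<close>.
\<close>

lemma functional_descent:
  obtains \<kappa> where "\<kappa> > 0" "\<And>Y (\<phi> :: ('i \<Rightarrow> 'v) \<Rightarrow> 'k) C \<eta>.
     finite Y \<Longrightarrow> Y \<subseteq> bounded_families \<Longrightarrow> C \<ge> 0 \<Longrightarrow> \<eta> > 0 \<Longrightarrow>
     (\<And>s. norm (\<Sum>y\<in>Y. s y * \<phi> y) \<le> C * ultra_norm smul U (F.comb Y s)) \<Longrightarrow>
     \<forall>\<^sub>F n in U. \<exists>f. bounded_functional smul (\<kappa> * C) f \<and> (\<forall>y\<in>Y. norm (f (y n) - \<phi> y) < \<eta>)"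
proof -
  obtain \<kappa> where \<kappa>: "\<kappa> > 0" and ext: "\<And>(J :: ('i \<Rightarrow> 'v) set) y \<alpha> C. finite J \<Longrightarrow> C \<ge> 0 \<Longrightarrow>
     (\<And>s. norm (\<Sum>j\<in>J. s j * \<alpha> j) \<le> C * norm (\<Sum>j\<in>J. smul (s j) (y j))) \<Longrightarrow>
     \<exists>f. bounded_functional smul (\<kappa> * C) f \<and> (\<forall>j\<in>J. f (y j) = \<alpha> j)"
    by (rule helly_extension[OF normed_space_over_axioms]) blast
  have "\<forall>\<^sub>F n in U. \<exists>f. bounded_functional smul ((2 * \<kappa>) * C) f \<and> (\<forall>y\<in>Y. norm (f (y n) - \<phi> y) < \<eta>)"
    if Y: "finite Y" "Y \<subseteq> bounded_families" and C: "C \<ge> 0" and \<eta>: "\<eta> > 0"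
      and hyp: "\<And>s. norm (\<Sum>y\<in>Y. s y * \<phi> y) \<le> C * ultra_norm smul U (F.comb Y s)"
    for Y and \<phi> :: "('i \<Rightarrow> 'v) \<Rightarrow> 'k" and C \<eta>
  proof -
    obtain J c t where J: "J \<subseteq> Y" "F.stably_independent c J" and t: "\<And>y. y \<in> Y \<Longrightarrow> ultra_norm smul U (y - F.comb J (t y)) = 0"
      using F.stably_independent_subset_exists[OF Y] by metis
    have fJ: "finite J" "J \<subseteq> bounded_families" using J Y finite_subset by auto
    have extend: "(\<Sum>y\<in>Y. (if y \<in> J then s y else 0) * \<phi> y) = (\<Sum>y\<in>J. s y * \<phi> y)"
      "F.comb Y (\<lambda>y. if y \<in> J then s y else 0) = F.comb J s" for s
      unfolding F.comb_def using J Y by (auto intro!: sum.mono_neutral_cong_right)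
    have \<phi>_rep: "\<phi> y = (\<Sum>x\<in>J. t y x * \<phi> x)" if y: "y \<in> Y" for y
    proof -
      let ?d = "\<lambda>x. if x = y then 1 else (0::'k)"
      have "F.comb Y ?d = y"
        unfolding F.comb_def using y Y by (simp add: if_distrib[of "\<lambda>c. pointwise_scale smul c _"] cong: if_cong)
      then have "F.comb Y (\<lambda>x. ?d x - (if x \<in> J then t y x else 0)) = y - F.comb J (t y)"
        by (simp only: F.comb_diff extend(2))
      moreover have "(\<Sum>x\<in>Y. (?d x - (if x \<in> J then t y x else 0)) * \<phi> x) = \<phi> y - (\<Sum>x\<in>J. t y x * \<phi> x)"
        unfolding left_diff_distrib sum_subtractf extend(1)
        using y Y by (simp add: if_distrib[of "\<lambda>c. c * _"] cong: if_cong)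
      ultimately show ?thesis
        using hyp[of "\<lambda>x. ?d x - (if x \<in> J then t y x else 0)"] t[OF y] by simp
    qed
    let ?C = "\<kappa> * (2 * C)"
    have C': "?C + 1 > 0" using C \<kappa> by (intro add_nonneg_pos) auto
    have "\<forall>\<^sub>F n in U. norm ((y - F.comb J (t y)) n) < \<eta> / (?C + 1)" if y: "y \<in> Y" for y
    proof (rule order_tendstoD(2))
      have "y - F.comb J (t y) \<in> bounded_families"
        using y Y F.comb_in[OF fJ(2)] by (intro bounded_families_diff) auto
      then show "((\<lambda>n. norm ((y - F.comb J (t y)) n)) \<longlongrightarrow> 0) U"
        using ultra_norm_tendsto[of "y - F.comb J (t y)"] t[OF y] by simp
      show "0 < \<eta> / (?C + 1)" using \<eta> C' by simp
    qed
    then have "\<forall>\<^sub>F n in U. \<forall>y\<in>Y. norm ((y - F.comb J (t y)) n) < \<eta> / (?C + 1)"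
      using Y by (intro eventually_ball_finite) auto
    then show ?thesis
      using eventually_uniform_lower_bound[OF fJ J(2)]
    proof eventually_elim
      case (elim n)
      have "norm (\<Sum>y\<in>J. s y * \<phi> y) \<le> (2 * C) * norm (\<Sum>y\<in>J. smul (s y) (y n))" for s
      proof -
        have "norm (\<Sum>y\<in>J. s y * \<phi> y) \<le> C * ultra_norm smul U (F.comb J s)"
          using hyp[of "\<lambda>y. if y \<in> J then s y else 0"] by (simp only: extend)
        also have "\<dots> \<le> C * (2 * norm (F.comb J s n))" using elim(2) C by (intro mult_left_mono) auto
        finally show ?thesis by (simp add: comb_apply mult_ac)
      qed
      then obtain f where f: "bounded_functional smul ?C f" "\<And>y. y \<in> J \<Longrightarrow> f (y n) = \<phi> y"
        using ext[OF fJ(1), where C = "2 * C" and y = "\<lambda>y. y n" and \<alpha> = \<phi>] C by auto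
      have add: "f (x + y) = f x + f y" and sc: "f (smul k x) = k * f x" and bd: "norm (f x) \<le> ?C * norm x" for x y k
        using f(1) by (auto simp: bounded_functional_def)
      have f0: "f 0 = 0" using add[of 0 0] by simp
      have fdiff: "f (x - y) = f x - f y" for x y using add[of "x - y" y] by simp
      have fsum: "f (\<Sum>x\<in>J. g x) = (\<Sum>x\<in>J. f (g x))" for g
        by (induction J rule: infinite_finite_induct) (auto simp: f0 add)
      have "norm (f (y n) - \<phi> y) < \<eta>" if y: "y \<in> Y" for y
      proof -
        have "f (F.comb J (t y) n) = \<phi> y"
          unfolding comb_apply fsum \<phi>_rep[OF y] using f(2) by (simp add: sc)
        then have "f (y n) - \<phi> y = f ((y - F.comb J (t y)) n)" by (simp add: fdiff)
        then have "norm (f (y n) - \<phi> y) \<le> ?C * norm ((y - F.comb J (t y)) n)" using bd by metis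
        also have "\<dots> \<le> (?C + 1) * norm ((y - F.comb J (t y)) n)" by (intro mult_right_mono) auto
        also have "\<dots> < (?C + 1) * (\<eta> / (?C + 1))" using elim(1) y C' by (intro mult_strict_left_mono) auto
        finally show ?thesis using C' by simp
      qed
      then show ?case using f(1) by (auto simp: mult_ac)
    qed
  qed
  then show thesis using \<kappa> by (intro that[of "2 * \<kappa>"]) simp_all
qed

text \<open>
  The coordinates \<open>\<phi> b\<close> are functions of families instead of classes, and their boundedness is stated
  in the form required by \<open>functional_descent\<close>.
\<close>

lemma finite_rank_coordinates:
  assumes T: "bounded_operator (ultrapower smul U) T" and fr: "finite_rank (ultrapower smul U) T"
  obtains J \<phi> C where "finite J" "J \<subseteq> bounded_families" "C \<ge> 0"
    "\<And>y. y \<in> bounded_families \<Longrightarrow> T (ultra_class U y) = ultra_class U (F.comb J (\<lambda>b. \<phi> b y))"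
    "\<And>b k y. b \<in> J \<Longrightarrow> y \<in> bounded_families \<Longrightarrow> \<phi> b (pointwise_scale smul k y) = k * \<phi> b y"
    "\<And>b Y s. b \<in> J \<Longrightarrow> finite Y \<Longrightarrow> Y \<subseteq> bounded_families \<Longrightarrow>
        norm (\<Sum>y\<in>Y. s y * \<phi> b y) \<le> C * ultra_norm smul U (F.comb Y s)"
proof -
  let ?E = "ultrapower smul U"
  obtain B where B: "finite B" "B \<subseteq> pts ?E" "T ` pts ?E \<subseteq> nspan ?E B"
    using fr by (auto simp: finite_rank_def)
  obtain B0 where B0: "finite B0" "B0 \<subseteq> bounded_families" "B = ultra_class U ` B0"
    using B finite_subset_image[of B "ultra_class U" bounded_families] by (auto simp: pts_ultrapower)
  have sub: "F.span B0 \<subseteq> bounded_families" using B0(2) F.subspace_S by (rule F.span_minimal)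
  have "nsubspace ?E (ultra_class U ` F.span B0)"
    unfolding nsubspace_def
  proof (intro conjI ballI allI)
    show "ultra_class U ` F.span B0 \<subseteq> pts ?E" using sub by (auto simp: pts_ultrapower)
    show "ultra_class U ` F.span B0 \<noteq> {}" using F.span_zero by blast
  next
    fix X Y assume "X \<in> ultra_class U ` F.span B0" "Y \<in> ultra_class U ` F.span B0"
    then obtain x y where "X = ultra_class U x" "Y = ultra_class U y" "x \<in> F.span B0" "y \<in> F.span B0" by auto
    then show "nadd ?E X Y \<in> ultra_class U ` F.span B0"
      using sub ultra_class_add[of x y smul U] F.span_add[of x B0 y] by auto
  next
    fix c X assume "X \<in> ultra_class U ` F.span B0"
    then obtain x where "X = ultra_class U x" "x \<in> F.span B0" by auto
    then show "nscale ?E c X \<in> ultra_class U ` F.span B0"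
      using sub ultra_class_scale[of x U c] F.span_scale[of x B0 c] by auto
  qed
  moreover have "B \<subseteq> ultra_class U ` F.span B0" using B0 F.span_base by auto
  ultimately have nspan: "nspan ?E B \<subseteq> ultra_class U ` F.span B0" by (auto simp: nspan_def)
  obtain J c where J: "J \<subseteq> B0" "F.stably_independent c J" "\<And>x. x \<in> F.span B0 \<Longrightarrow> \<exists>t. ultra_norm smul U (x - F.comb J t) = 0"
    using F.span_comb_classes[OF B0(1,2)] by metis
  have fJ: "finite J" "J \<subseteq> bounded_families" using J B0 finite_subset by auto
  have c: "c > 0" using J(2) by (simp add: F.stably_independent_def)
  have comb_in: "F.comb J t \<in> bounded_families" for t by (rule F.comb_in[OF fJ(2)])
  have "\<exists>t. T (ultra_class U y) = ultra_class U (F.comb J t)" if y: "y \<in> bounded_families" for y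
  proof -
    have "T (ultra_class U y) \<in> ultra_class U ` F.span B0"
      using B(3) nspan y by (auto simp: pts_ultrapower)
    then obtain z where z: "T (ultra_class U y) = ultra_class U z" "z \<in> F.span B0" by blast
    then obtain t where "ultra_norm smul U (z - F.comb J t) = 0" using J(3) by blast
    then show ?thesis using z sub comb_in[of t] ultra_class_eq_iff_norm[of z "F.comb J t"] by auto
  qed
  then obtain \<psi> where \<psi>: "\<And>y. y \<in> bounded_families \<Longrightarrow> T (ultra_class U y) = ultra_class U (F.comb J (\<psi> y))"
    by metis
  have uniq: "s b = t b" if "b \<in> J" "ultra_class U (F.comb J s) = ultra_class U (F.comb J t)" for s t b
  proof -
    have "ultra_norm smul U (F.comb J (\<lambda>b. s b - t b)) = 0"
      using that(2) ultra_class_eq_iff_norm[OF comb_in comb_in, of s t] by (simp only: F.comb_diff)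
    then have "c * norm (s b - t b) \<le> 0"
      using J(2) that(1) unfolding F.stably_independent_def by (metis (no_types, lifting))
    then show ?thesis using c by (simp add: mult_le_0_iff)
  qed
  have T_add: "T (nadd ?E X Y) = nadd ?E (T X) (T Y)" if "X \<in> pts ?E" "Y \<in> pts ?E" for X Y
    using T that by (auto simp: bounded_operator_def)
  have T_scale: "T (nscale ?E k X) = nscale ?E k (T X)" if "X \<in> pts ?E" for X k
    using T that by (auto simp: bounded_operator_def)
  have add: "\<psi> (x + y) b = \<psi> x b + \<psi> y b"
    if "b \<in> J" "x \<in> bounded_families" "y \<in> bounded_families" for x y b
  proof -
    have "ultra_class U (F.comb J (\<psi> (x + y))) = T (nadd ?E (ultra_class U x) (ultra_class U y))"
      using that by (simp add: \<psi>[OF bounded_families_add] ultra_class_add)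
    also have "\<dots> = nadd ?E (T (ultra_class U x)) (T (ultra_class U y))"
      using that by (intro T_add) (auto simp: pts_ultrapower)
    also have "\<dots> = ultra_class U (F.comb J (\<psi> x) + F.comb J (\<psi> y))"
      using that by (simp add: \<psi> ultra_class_add comb_in)
    finally show ?thesis using uniq[OF that(1)] by (simp add: F.comb_add[symmetric])
  qed
  have scale: "\<psi> (pointwise_scale smul k y) b = k * \<psi> y b"
    if "b \<in> J" "y \<in> bounded_families" for y b k
  proof -
    have "ultra_class U (F.comb J (\<psi> (pointwise_scale smul k y))) = T (nscale ?E k (ultra_class U y))"
      using that by (simp add: \<psi>[OF bounded_families_scale] ultra_class_scale)
    also have "\<dots> = nscale ?E k (T (ultra_class U y))"
      using that by (intro T_scale) (auto simp: pts_ultrapower)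
    also have "\<dots> = ultra_class U (pointwise_scale smul k (F.comb J (\<psi> y)))"
      using that by (simp add: \<psi> ultra_class_scale comb_in)
    finally show ?thesis using uniq[OF that(1)] by (simp add: F.comb_scale[symmetric])
  qed
  have zero: "\<psi> 0 b = 0" if "b \<in> J" for b
    using scale[OF that F.subspace_0[OF F.subspace_S], of 0] by simp
  have comb: "(\<Sum>y\<in>Y. s y * \<psi> y b) = \<psi> (F.comb Y s) b"
    if "b \<in> J" "finite Y" "Y \<subseteq> bounded_families" for b Y s
    using that(2,3)
  proof (induction Y rule: finite_induct)
    case empty
    show ?case using zero[OF that(1)] by (simp add: F.comb_def zero_fun_def)
  next
    case (insert y Y)
    have "F.comb (insert y Y) s = pointwise_scale smul (s y) y + F.comb Y s"
      using insert by (simp add: F.comb_def)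
    then have "\<psi> (F.comb (insert y Y) s) b = \<psi> (pointwise_scale smul (s y) y) b + \<psi> (F.comb Y s) b"
      using insert that(1) by (simp only: add bounded_families_scale F.comb_in insert_subset)
    then show ?case
      using insert that(1) by (simp add: scale)
  qed
  obtain C0 where C0: "\<And>X. X \<in> pts ?E \<Longrightarrow> nnorm ?E (T X) \<le> C0 * nnorm ?E X"
    using T unfolding bounded_operator_def by blast
  define C where "C = \<bar>C0\<bar> / c"
  have bd: "norm (\<psi> y b) \<le> C * ultra_norm smul U y" if "b \<in> J" "y \<in> bounded_families" for b y
  proof -
    have "c * norm (\<psi> y b) \<le> ultra_norm smul U (F.comb J (\<psi> y))"
      using J(2) that(1) by (auto simp: F.stably_independent_def)
    also have "\<dots> = nnorm ?E (T (ultra_class U y))" by (simp add: \<psi>[OF that(2)])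
    also have "\<dots> \<le> C0 * ultra_norm smul U y" using that by (intro C0) (auto simp: pts_ultrapower)
    also have "\<dots> \<le> \<bar>C0\<bar> * ultra_norm smul U y" using F.N_nonneg[OF that(2)] by (intro mult_right_mono) auto
    finally show ?thesis using c by (simp add: C_def field_simps)
  qed
  have "C \<ge> 0" using c by (simp add: C_def)
  moreover have "norm (\<Sum>y\<in>Y. s y * \<psi> y b) \<le> C * ultra_norm smul U (F.comb Y s)"
    if "b \<in> J" "finite Y" "Y \<subseteq> bounded_families" for b Y s
    unfolding comb[OF that] by (rule bd[OF that(1) F.comb_in[OF that(3)]])
  ultimately show thesis
    by (intro that[of J C "\<lambda>b y. \<psi> y b"] fJ \<psi> scale)
qed

end


section \<open>Bilinear maps on the projective tensor product\<close>

text \<open>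
  A bounded bilinear map extends to the projective tensor product. For the present representation
  of tensors by finitely supported functions, this means that it is continuous for the projective norm and
  vanishes on the bilinearity relations.
\<close>

locale balanced_map = V: normed_space_over scaleV
  for scaleV :: "'k::{real_normed_field,heine_borel} \<Rightarrow> 'v::real_normed_vector \<Rightarrow> 'v" +
  fixes scaleA :: "'k \<Rightarrow> 'a::real_normed_vector \<Rightarrow> 'a"
    and scaleB :: "'k \<Rightarrow> 'b::real_normed_vector \<Rightarrow> 'b"
    and \<beta> :: "'a \<Rightarrow> 'b \<Rightarrow> 'v" and K :: real
  assumes add_left: "\<beta> (a + a') b = \<beta> a b + \<beta> a' b"
    and add_right: "\<beta> a (b + b') = \<beta> a b + \<beta> a b'"
    and scale_left: "\<beta> (scaleA r a) b = scaleV r (\<beta> a b)"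
    and scale_right: "\<beta> a (scaleB r b) = scaleV r (\<beta> a b)"
    and bound: "norm (\<beta> a b) \<le> K * (norm a * norm b)"
    and K_nonneg: "K \<ge> 0"
begin

sublocale T: vector_space "pointwise_scale (*) :: 'k \<Rightarrow> ('a \<times> 'b \<Rightarrow> 'k) \<Rightarrow> 'a \<times> 'b \<Rightarrow> 'k"
  by unfold_locales (auto simp: pointwise_scale_def fun_eq_iff algebra_simps)

definition lift :: "('a \<times> 'b \<Rightarrow> 'k) \<Rightarrow> 'v" where
  "lift u = (\<Sum>p | u p \<noteq> 0. scaleV (u p) (\<beta> (fst p) (snd p)))"

lemma lift_eq: "finite S \<Longrightarrow> {p. u p \<noteq> 0} \<subseteq> S \<Longrightarrow> lift u = (\<Sum>p\<in>S. scaleV (u p) (\<beta> (fst p) (snd p)))"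
  unfolding lift_def by (rule sum.mono_neutral_left) auto

definition finitely_supported :: "('a \<times> 'b \<Rightarrow> 'k) set" where "finitely_supported = {u. finite {p. u p \<noteq> 0}}"

lemma subspace_finitely_supported: "T.subspace finitely_supported"
proof (rule T.subspaceI)
  show "0 \<in> finitely_supported" by (simp add: finitely_supported_def)
next
  fix u v assume "u \<in> finitely_supported" "v \<in> finitely_supported"
  then show "u + v \<in> finitely_supported"
    by (auto simp: finitely_supported_def intro: finite_subset[of _ "{p. u p \<noteq> 0} \<union> {p. v p \<noteq> 0}"])
next
  fix c u assume "u \<in> finitely_supported"
  then show "pointwise_scale (*) c u \<in> finitely_supported"
    by (auto simp: finitely_supported_def pointwise_scale_def intro: finite_subset[of _ "{p. u p \<noteq> 0}"])
qed

lemma lift_add: "u \<in> finitely_supported \<Longrightarrow> v \<in> finitely_supported \<Longrightarrow> lift (u + v) = lift u + lift v"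
  by (subst (1 2 3) lift_eq[of "{p. u p \<noteq> 0} \<union> {p. v p \<noteq> 0}"])
    (auto simp: finitely_supported_def V.scale_left_distrib sum.distrib)

lemma lift_scale: "u \<in> finitely_supported \<Longrightarrow> lift (pointwise_scale (*) c u) = scaleV c (lift u)"
  by (subst (1 2) lift_eq[of "{p. u p \<noteq> 0}"])
    (auto simp: finitely_supported_def pointwise_scale_def V.scale_sum_right)

lemma lift_diff: "u \<in> finitely_supported \<Longrightarrow> v \<in> finitely_supported \<Longrightarrow> lift (u - v) = lift u - lift v"
  using lift_add[of "u - v" v] T.subspace_diff[OF subspace_finitely_supported] by simp

lemma tens_finitely_supported: "tens a b \<in> finitely_supported"
  by (simp add: finitely_supported_def tens_def)

lemma lift_tens: "lift (tens a b) = \<beta> a b"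
  by (subst lift_eq[of "{(a, b)}"]) (auto simp: tens_def)

lemma sum_finitely_supported: "(\<And>i. i \<in> I \<Longrightarrow> g i \<in> finitely_supported) \<Longrightarrow> sum g I \<in> finitely_supported"
  by (rule T.subspace_sum[OF subspace_finitely_supported])

lemma lift_sum: "(\<And>i. i \<in> I \<Longrightarrow> g i \<in> finitely_supported) \<Longrightarrow> lift (sum g I) = (\<Sum>i\<in>I. lift (g i))"
  by (induction I rule: infinite_finite_induct)
    (auto simp: lift_add sum_finitely_supported, simp_all add: lift_def)

lemma lift_null: "u \<in> tensor_null scaleA scaleB \<Longrightarrow> u \<in> finitely_supported \<and> lift u = 0"
proof -
  have sub: "T.subspace {u \<in> finitely_supported. lift u = 0}"
  proof (rule T.subspaceI)
    show "0 \<in> {u \<in> finitely_supported. lift u = 0}" using T.subspace_0[OF subspace_finitely_supported] by (simp add: lift_def)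
  qed (use T.subspace_add[OF subspace_finitely_supported] T.subspace_scale[OF subspace_finitely_supported] in
      \<open>auto simp: lift_add lift_scale\<close>)
  have "tensor_relations scaleA scaleB \<subseteq> {u \<in> finitely_supported. lift u = 0}"
    unfolding tensor_relations_def
    by (auto simp: lift_diff lift_scale lift_tens add_left add_right scale_left scale_right
        intro!: T.subspace_diff[OF subspace_finitely_supported] T.subspace_scale[OF subspace_finitely_supported] tens_finitely_supported)
      (simp_all add: lift_diff lift_scale lift_tens add_left add_right scale_left scale_right tens_finitely_supported
        T.subspace_diff[OF subspace_finitely_supported] T.subspace_scale[OF subspace_finitely_supported])
  then have "tensor_null scaleA scaleB \<subseteq> {u \<in> finitely_supported. lift u = 0}"
    unfolding tensor_null_def using sub by (rule T.span_minimal)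
  then show "u \<in> tensor_null scaleA scaleB \<Longrightarrow> u \<in> finitely_supported \<and> lift u = 0" by blast
qed

lemma norm_lift_le:
  assumes u: "u \<in> finitely_supported" and ne: "u - (\<Sum>(a, b)\<leftarrow>ys. tens a b) \<in> tensor_null scaleA scaleB"
  shows "norm (lift u) \<le> K * projective_norm scaleA scaleB u"
proof -
  have list: "(\<Sum>(a, b)\<leftarrow>xs. tens a b) \<in> finitely_supported \<and> lift (\<Sum>(a, b)\<leftarrow>xs. tens a b) = (\<Sum>(a, b)\<leftarrow>xs. \<beta> a b)"
    for xs :: "('a \<times> 'b) list"
  proof (induction xs)
    case Nil
    then show ?case using T.subspace_0[OF subspace_finitely_supported] by (simp add: lift_def zero_fun_def)
  next
    case (Cons p xs)
    have eq: "(\<Sum>(a, b)\<leftarrow>p # xs. tens a b) = tens (fst p) (snd p) + (\<Sum>(a, b)\<leftarrow>xs. tens a b)"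
      by (cases p) (simp only: list.map sum_list.Cons prod.case fst_conv snd_conv)
    show ?case
      unfolding eq using T.subspace_add[OF subspace_finitely_supported tens_finitely_supported] Cons
      by (cases p) (simp add: lift_add[OF tens_finitely_supported] lift_tens del: plus_fun_apply)
  qed
  have le: "norm (lift u) \<le> K * (\<Sum>(a, b)\<leftarrow>xs. norm a * norm b)"
    if "u - (\<Sum>(a, b)\<leftarrow>xs. tens a b) \<in> tensor_null scaleA scaleB" for xs
  proof -
    have "lift u = (\<Sum>(a, b)\<leftarrow>xs. \<beta> a b)"
      using lift_null[OF that] list[of xs] u by (simp add: lift_diff)
    moreover have "norm (\<Sum>(a, b)\<leftarrow>xs. \<beta> a b) \<le> K * (\<Sum>(a, b)\<leftarrow>xs. norm a * norm b)"
    proof (induction xs)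
      case (Cons p xs)
      then show ?case
        using bound[of "fst p" "snd p"] norm_triangle_ineq[of "\<beta> (fst p) (snd p)" "\<Sum>(a, b)\<leftarrow>xs. \<beta> a b"]
        by (cases p) (simp add: distrib_left)
    qed simp
    ultimately show ?thesis by simp
  qed
  show ?thesis
  proof (cases "K = 0")
    case True
    then show ?thesis using le[OF ne] by simp
  next
    case False
    then have K: "K > 0" using K_nonneg by simp
    have "norm (lift u) / K \<le> projective_norm scaleA scaleB u"
      unfolding projective_norm_def
    proof (rule cInf_greatest)
      show "{\<Sum>(a, b)\<leftarrow>xs. norm a * norm b | xs. u - (\<Sum>(a, b)\<leftarrow>xs. tens a b) \<in> tensor_null scaleA scaleB} \<noteq> {}"
        using ne by blast
    qed (use le K in \<open>auto simp: field_simps\<close>)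
    then show ?thesis using K by (simp add: field_simps)
  qed
qed

lemma projective_sum_eq_tendsto:
  assumes "projective_sum_eq scaleA scaleB s t"
  shows "(\<lambda>n. (\<Sum>i<n. \<beta> (fst (s i)) (snd (s i))) - (\<Sum>i<n. \<beta> (fst (t i)) (snd (t i)))) \<longlonglongrightarrow> 0"
proof -
  let ?u = "\<lambda>n. (\<Sum>i<n. tens (fst (s i)) (snd (s i))) - (\<Sum>i<n. tens (fst (t i)) (snd (t i))) :: 'a \<times> 'b \<Rightarrow> 'k"
  have supp: "?u n \<in> finitely_supported" for n by (intro T.subspace_diff[OF subspace_finitely_supported] sum_finitely_supported tens_finitely_supported)
  have le: "norm (lift (?u n)) \<le> K * projective_norm scaleA scaleB (?u n)" for n
  proof (rule norm_lift_le[OF supp])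
    \<comment> \<open>The bound by the infimum is informative only if there is at least one representation of \<open>?u n\<close> by elementary tensors.\<close>
    let ?ys = "map s [0..<n] @ map (\<lambda>i. (scaleA (- 1) (fst (t i)), snd (t i))) [0..<n]"
    have minus: "pointwise_scale (*) (- 1) f = - f" for f :: "'a \<times> 'b \<Rightarrow> 'k"
      by (simp add: pointwise_scale_def fun_eq_iff)
    have "?u n - (\<Sum>(a, b)\<leftarrow>?ys. tens a b) =
        - (\<Sum>i<n. tens (scaleA (- 1) (fst (t i))) (snd (t i)) - pointwise_scale (*) (- 1) (tens (fst (t i)) (snd (t i))))"
      unfolding minus
      by (simp add: sum_list_distinct_conv_sum_set comp_def case_prod_unfold atLeast0LessThan sum.distrib)
    also have "\<dots> \<in> tensor_null scaleA scaleB"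
      unfolding tensor_null_def
      by (intro T.span_neg T.span_sum T.span_base) (unfold tensor_relations_def, blast)
    finally show "?u n - (\<Sum>(a, b)\<leftarrow>?ys. tens a b) \<in> tensor_null scaleA scaleB" .
  qed
  have "(\<lambda>n. lift (?u n)) \<longlonglongrightarrow> 0"
  proof (rule Lim_null_comparison[OF always_eventually])
    show "\<forall>n. norm (lift (?u n)) \<le> K * projective_norm scaleA scaleB (?u n)" using le by blast
    show "(\<lambda>n. K * projective_norm scaleA scaleB (?u n)) \<longlonglongrightarrow> 0"
      using assms unfolding projective_sum_eq_def by (rule tendsto_mult_right_zero)
  qed
  then show ?thesis by (simp add: lift_diff lift_sum sum_finitely_supported tens_finitely_supported lift_tens)
qed

end


section \<open>Averaging along a diagonal\<close>

text \<open>
  A convergent series converges slightly better than necessary: take \<open>\<rho>\<close> to be the square root of the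
  tails \<open>r\<close>, since \<open>s k = \<rho> k ^ 2 - \<rho> (Suc k) ^ 2\<close> makes the new series telescope.
\<close>

lemma summable_div_null_sequence:
  fixes s :: "nat \<Rightarrow> real"
  assumes s: "summable s" and nonneg: "\<And>k. s k \<ge> 0"
  shows "\<exists>\<rho>. (\<forall>k. \<rho> k \<ge> 0) \<and> (\<forall>k. s k > 0 \<longrightarrow> \<rho> k > 0) \<and> \<rho> \<longlonglongrightarrow> 0 \<and> summable (\<lambda>k. s k / \<rho> k)"
proof -
  define r where "r k = (\<Sum>j. s (j + k))" for k
  have r_Suc: "r k = s k + r (Suc k)" for k
    using suminf_split_head[of "\<lambda>j. s (j + k)"] s by (simp add: r_def summable_ignore_initial_segment)
  have r0: "r k \<ge> 0" for k
    unfolding r_def by (intro suminf_nonneg) (use s nonneg in \<open>auto simp: summable_ignore_initial_segment\<close>)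
  have rlim: "r \<longlonglongrightarrow> 0" unfolding r_def by (rule suminf_exist_split2[OF s])
  define \<rho> where "\<rho> k = sqrt (r k)" for k
  have \<rho>lim: "\<rho> \<longlonglongrightarrow> 0" unfolding \<rho>_def using tendsto_real_sqrt[OF rlim] by simp
  have pos: "\<rho> k > 0" if "s k > 0" for k
    using that r_Suc[of k] r0[of "Suc k"] by (simp add: \<rho>_def)
  have le: "s k / \<rho> k \<le> 2 * (\<rho> k - \<rho> (Suc k))" for k
  proof (cases "s k = 0")
    case True
    then show ?thesis using r_Suc[of k] by (simp add: \<rho>_def)
  next
    case False
    then have p: "\<rho> k > 0" using pos nonneg[of k] by (simp add: less_le)
    have mono: "\<rho> (Suc k) \<le> \<rho> k" using r_Suc[of k] nonneg[of k] by (simp add: \<rho>_def)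
    have "s k = \<rho> k ^ 2 - \<rho> (Suc k) ^ 2" unfolding \<rho>_def using r_Suc[of k] r0[of k] r0[of "Suc k"] by simp
    also have "\<dots> = (\<rho> k - \<rho> (Suc k)) * (\<rho> k + \<rho> (Suc k))" by (simp add: power2_eq_square algebra_simps)
    also have "\<dots> \<le> (\<rho> k - \<rho> (Suc k)) * (2 * \<rho> k)" using mono by (intro mult_left_mono) auto
    finally show ?thesis using p by (simp add: field_simps)
  qed
  have "summable (\<lambda>k. 2 * (\<rho> k - \<rho> (Suc k)))"
    by (intro summable_mult telescope_summable'[OF \<rho>lim])
  then have "summable (\<lambda>k. s k / \<rho> k)"
    by (rule summable_comparison_test') (use le nonneg r0 in \<open>auto simp: \<rho>_def\<close>)
  then show ?thesis using \<rho>lim pos r0 by (intro exI[of _ \<rho>]) (auto simp: \<rho>_def)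
qed

lemma norm_suminf_split_le:
  fixes t :: "nat \<Rightarrow> 'v::banach"
  assumes s: "summable s" and K: "\<And>k. norm (t k) \<le> K * s k" and g: "\<And>k. k < m \<Longrightarrow> norm (t k) \<le> g k"
  shows "summable t" and "norm (\<Sum>k. t k) \<le> (\<Sum>k<m. g k) + K * (\<Sum>k. s (k + m))"
proof -
  have sK: "summable (\<lambda>k. K * s k)" using s by (rule summable_mult)
  show t: "summable t" by (rule summable_comparison_test'[OF sK]) (rule K)
  have "(\<Sum>k. t k) = (\<Sum>k<m. t k) + (\<Sum>k. t (k + m))"
    using suminf_split_initial_segment[OF t, of m] by simp
  moreover have "norm (\<Sum>k<m. t k) \<le> (\<Sum>k<m. g k)" using g by (intro sum_norm_le) auto
  moreover have "norm (\<Sum>k. t (k + m)) \<le> (\<Sum>k. K * s (k + m))"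
    by (rule norm_suminf_le) (use K sK in \<open>auto simp: summable_iff_shift[of "\<lambda>k. K * s k" m]\<close>)
  moreover have "(\<Sum>k. K * s (k + m)) = K * (\<Sum>k. s (k + m))"
    using s by (intro suminf_mult) (simp add: summable_ignore_initial_segment)
  ultimately show "norm (\<Sum>k. t k) \<le> (\<Sum>k<m. g k) + K * (\<Sum>k. s (k + m))"
    using norm_triangle_ineq[of "\<Sum>k<m. t k" "\<Sum>k. t (k + m)"] by simp
qed

locale diagonal_module = left_banach_module scaleA scaleV act
  for scaleA :: "'k::{real_normed_field,heine_borel} \<Rightarrow> 'a::{real_normed_algebra,monoid_mult,banach} \<Rightarrow> 'a"
    and scaleV :: "'k \<Rightarrow> 'v::banach \<Rightarrow> 'v"
    and act :: "'a \<Rightarrow> 'v \<Rightarrow> 'v" +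
  fixes c d :: "nat \<Rightarrow> 'a" and B :: real
  assumes diagonal: "is_diagonal scaleA c d"
    and B_nonneg: "B \<ge> 0"
    and norm_act: "norm (act a v) \<le> B * (norm a * norm v)"
begin

definition weight :: "nat \<Rightarrow> real" where "weight k = norm (c k) * norm (d k)"

lemma weight: "summable weight" "weight k \<ge> 0"
  using diagonal by (auto simp: is_diagonal_def weight_def[abs_def])

definition tail :: "nat \<Rightarrow> real" where "tail m = (\<Sum>k. weight (k + m))"

lemma tail: "tail \<longlonglongrightarrow> 0" "tail m \<ge> 0"
  unfolding tail_def
  by (rule suminf_exist_split2[OF weight(1)], intro suminf_nonneg)
    (auto simp: weight summable_ignore_initial_segment)

lemma tail_small: "e > 0 \<Longrightarrow> \<exists>m. L * tail m \<le> e"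
proof -
  assume e: "e > 0"
  have "(\<lambda>m. L * tail m) \<longlonglongrightarrow> 0" using tendsto_mult_right_zero[OF tail(1)] .
  then have "\<forall>\<^sub>F m in sequentially. L * tail m < e" using e by (rule order_tendstoD)
  then show ?thesis by (auto simp: eventually_sequentially intro: less_imp_le)
qed

text \<open>
  The average \<open>\<Sum> c\<^sub>k T d\<^sub>k\<close> of the rank-one operator \<open>T = f \<otimes> x\<close> along the diagonal.
\<close>

definition averaged :: "('v \<Rightarrow> 'k) \<Rightarrow> 'v \<Rightarrow> 'v \<Rightarrow> 'v" where
  "averaged f x u = (\<Sum>k. scaleV (f (act (d k) u)) (act (c k) x))"

lemma norm_averaging_le:
  fixes M m :: nat
  assumes L: "\<And>k j. j < M \<Longrightarrow> norm (t k j) \<le> L * norm (d k)"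
    and x: "\<And>j. j < M \<Longrightarrow> norm (x j) \<le> C" and C: "C \<ge> 0"
    and small: "\<And>k j. k < m \<Longrightarrow> j < M \<Longrightarrow> norm (t k j) \<le> \<eta>"
  shows "summable (\<lambda>k. \<Sum>j<M. scaleV (t k j) (act (c k) (x j)))"
    and "norm (\<Sum>k. \<Sum>j<M. scaleV (t k j) (act (c k) (x j))) \<le>
       (\<Sum>k<m. norm (c k)) * (B * M * C * \<eta>) + (B * M * C * L) * tail m"
proof -
  let ?t = "\<lambda>k. \<Sum>j<M. scaleV (t k j) (act (c k) (x j))"
  have le: "norm (?t k) \<le> norm (c k) * (B * M * C * e)" if "\<And>j. j < M \<Longrightarrow> norm (t k j) \<le> e" for k e
  proof -
    have "norm (?t k) \<le> (\<Sum>j<M. e * (B * (norm (c k) * C)))"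
    proof (rule sum_norm_le)
      fix j assume j: "j \<in> {..<M}"
      have "norm (act (c k) (x j)) \<le> B * (norm (c k) * norm (x j))" by (rule norm_act)
      also have "\<dots> \<le> B * (norm (c k) * C)" using x j B_nonneg by (intro mult_left_mono) auto
      finally show "norm (scaleV (t k j) (act (c k) (x j))) \<le> e * (B * (norm (c k) * C))"
        unfolding V.norm_scale using that[of j] j order_trans[OF norm_ge_zero that[of j]]
        by (intro mult_mono) auto
    qed
    then show ?thesis by (simp add: mult_ac)
  qed
  have K: "norm (?t k) \<le> (B * M * C * L) * weight k" for k
    using le[of k "L * norm (d k)"] L by (simp add: weight_def mult_ac)
  have g: "norm (?t k) \<le> norm (c k) * (B * M * C * \<eta>)" if "k < m" for k
    using le[of k \<eta>] small that by simp
  show "summable ?t" by (rule norm_suminf_split_le(1)[OF weight(1) K g])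
  show "norm (\<Sum>k. ?t k) \<le> (\<Sum>k<m. norm (c k)) * (B * M * C * \<eta>) + (B * M * C * L) * tail m"
    unfolding sum_distrib_right tail_def by (rule norm_suminf_split_le(2)[OF weight(1) K g])
qed

lemma averaged_summable:
  assumes f: "bounded_functional scaleV C f"
  shows "summable (\<lambda>k. scaleV (f (act (d k) u)) (act (c k) x))"
proof (cases "C \<ge> 0")
  case True
  have "norm (f (act (d k) u)) \<le> (C * B * norm u) * norm (d k)" for k
  proof -
    have "norm (f (act (d k) u)) \<le> C * norm (act (d k) u)" using f by (simp add: bounded_functional_def)
    also have "\<dots> \<le> C * (B * (norm (d k) * norm u))" by (intro mult_left_mono norm_act True)
    finally show ?thesis by (simp add: mult_ac)
  qed
  then show ?thesis
    using norm_averaging_le(1)[of 1 "\<lambda>k j. f (act (d k) u)" "C * B * norm u" "\<lambda>_. x" "norm x" 0 0] by simp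
next
  case False
  have "f y = 0" for y
  proof -
    have "norm (f y) \<le> C * norm y" using f by (simp add: bounded_functional_def)
    moreover have "C * norm y \<le> 0" using False by (intro mult_nonpos_nonneg) auto
    ultimately have "norm (f y) \<le> 0" by linarith
    then show ?thesis by simp
  qed
  then show ?thesis by simp
qed

lemma sum_averaged:
  fixes M :: nat
  assumes "\<And>j. j < M \<Longrightarrow> bounded_functional scaleV C (f j)"
  shows "(\<Sum>j<M. averaged (f j) (x j) (u j)) = (\<Sum>k. \<Sum>j<M. scaleV (f j (act (d k) (u j))) (act (c k) (x j)))"
  unfolding averaged_def by (rule suminf_sum[symmetric]) (use assms averaged_summable in blast)

text \<open>
  For fixed \<open>f\<close>, \<open>x\<close> and \<open>u\<close>, the bilinear map \<open>(p, q) \<mapsto> f (q u) p x\<close> sends the identity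
  \<open>\<Sum> a c\<^sub>k \<otimes> d\<^sub>k = \<Sum> c\<^sub>k \<otimes> d\<^sub>k a\<close> in the projective tensor product to this one.
\<close>

lemma act_averaged:
  assumes f: "bounded_functional scaleV C f"
  shows "act a (averaged f x u) = averaged f x (act a u)"
proof -
  have C: "norm (f v) \<le> \<bar>C\<bar> * norm v" for v
    using f mult_right_mono[of C "\<bar>C\<bar>" "norm v"] unfolding bounded_functional_def
    by (meson abs_ge_self norm_ge_zero order_trans)
  interpret b: balanced_map scaleV scaleA scaleA "\<lambda>p q. scaleV (f (act q u)) (act p x)"
    "\<bar>C\<bar> * B * norm u * B * norm x"
  proof
    fix p q
    have "norm (f (act q u)) \<le> \<bar>C\<bar> * (B * (norm q * norm u))"
      using C[of "act q u"] mult_left_mono[OF norm_act[of q u], of "\<bar>C\<bar>"] by simp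
    then have "norm (f (act q u)) * norm (act p x) \<le> (\<bar>C\<bar> * (B * (norm q * norm u))) * (B * (norm p * norm x))"
      using norm_act[of p x] B_nonneg by (intro mult_mono) auto
    then show "norm (scaleV (f (act q u)) (act p x)) \<le> \<bar>C\<bar> * B * norm u * B * norm x * (norm p * norm q)"
      by (simp add: V.norm_scale mult_ac)
  qed (use f B_nonneg in \<open>auto simp: bounded_functional_def add_left add_right act_scale_left act_scale_right
        V.scale_left_distrib V.scale_right_distrib mult_ac\<close>)
  let ?l = "\<lambda>k. scaleV (f (act (d k) u)) (act (a * c k) x)"
  let ?r = "\<lambda>k. scaleV (f (act (d k * a) u)) (act (c k) x)"
  have "(\<lambda>n. (\<Sum>k<n. ?l k) - (\<Sum>k<n. ?r k)) \<longlonglongrightarrow> 0"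
    using b.projective_sum_eq_tendsto[of "\<lambda>k. (a * c k, d k)" "\<lambda>k. (c k, d k * a)"] diagonal
    by (simp add: is_diagonal_def)
  moreover have "?l sums act a (averaged f x u)"
    using bounded_linear.sums[OF bounded_linear_right summable_sums[OF averaged_summable[OF f, of u x]], of a]
    by (simp add: averaged_def act_scale_right act_mult)
  moreover have "?r sums averaged f x (act a u)"
    using summable_sums[OF averaged_summable[OF f, of "act a u" x]]
    by (simp add: averaged_def act_mult)
  ultimately have "(\<lambda>n. (\<Sum>k<n. ?l k) - (\<Sum>k<n. ?r k)) \<longlonglongrightarrow> act a (averaged f x u) - averaged f x (act a u)"
    unfolding sums_def by (intro tendsto_diff)
  with \<open>(\<lambda>n. (\<Sum>k<n. ?l k) - (\<Sum>k<n. ?r k)) \<longlonglongrightarrow> 0\<close> show ?thesis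
    using LIMSEQ_unique by fastforce
qed

lemma act_one_sums: "(\<lambda>k. act (c k) (act (d k) v)) sums act 1 v"
  using bounded_linear.sums[OF bounded_linear_left, of "\<lambda>k. c k * d k" 1 v] diagonal
  by (simp add: is_diagonal_def act_mult)

lemma act_act_one: "act a (act 1 v) = act a v"
  by (simp add: act_mult[symmetric])

text \<open>
  The average of some operator of rank at most \<open>M\<close> and norm controlled by \<open>C\<close> maps \<open>v\<close> to within
  \<open>\<epsilon>\<close> of \<open>act 1 v\<close>. The module need not be unital, so \<open>act 1 v\<close> takes the place of \<open>v\<close>.
\<close>

definition averageable :: "real \<Rightarrow> nat \<Rightarrow> real \<Rightarrow> 'v \<Rightarrow> bool" where
  "averageable \<epsilon> M C v \<longleftrightarrow>
     (\<exists>f x. (\<forall>j<M. bounded_functional scaleV C (f j) \<and> norm (x j) \<le> C) \<and>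
        norm ((\<Sum>j<M. averaged (f j) (x j) v) - act 1 v) \<le> \<epsilon>)"

lemma averageable_mono:
  assumes v: "averageable \<epsilon> M C v" and le: "M \<le> M'" "C \<le> C'" "0 \<le> C'"
  shows "averageable \<epsilon> M' C' v"
proof -
  obtain f x where f: "\<And>j. j < M \<Longrightarrow> bounded_functional scaleV C (f j)" and x: "\<And>j. j < M \<Longrightarrow> norm (x j) \<le> C"
    and est: "norm ((\<Sum>j<M. averaged (f j) (x j) v) - act 1 v) \<le> \<epsilon>"
    using v unfolding averageable_def by blast
  let ?f = "\<lambda>j. if j < M then f j else (\<lambda>_. 0)" and ?x = "\<lambda>j. if j < M then x j else 0"
  have "averaged (?f j) (?x j) v = 0" if "\<not> j < M" for j using that by (simp add: averaged_def)
  then have "(\<Sum>j<M'. averaged (?f j) (?x j) v) = (\<Sum>j<M. averaged (f j) (x j) v)"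
    using le by (intro sum.mono_neutral_cong_right) auto
  moreover have "bounded_functional scaleV C' (?f j)" for j
  proof (cases "j < M")
    case True
    have "norm (f j y) \<le> C' * norm y" for y
      using f[OF True] mult_right_mono[OF le(2) norm_ge_zero[of y]]
      unfolding bounded_functional_def by (meson order_trans)
    then show ?thesis using f[OF True] True by (simp add: bounded_functional_def)
  qed (use le in \<open>simp add: bounded_functional_def\<close>)
  moreover have "norm (?x j) \<le> C'" for j using x[of j] le by (cases "j < M") auto
  ultimately show ?thesis using est unfolding averageable_def by (intro exI[of _ ?f] exI[of _ ?x]) simp
qed

end


section \<open>Finite dimension from uniform averaging\<close>

text \<open>
  Each \<open>g v\<close> is rounded to a finite \<open>\<eta> / 2\<close>-net in every coordinate, and one \<open>v\<close> is kept for every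
  rounded value that occurs.
\<close>

lemma finite_representatives:
  fixes g :: "'x \<Rightarrow> 'i \<Rightarrow> 'k::{real_normed_vector,heine_borel}"
  assumes I: "finite I" and bd: "\<And>v i. v \<in> X \<Longrightarrow> i \<in> I \<Longrightarrow> norm (g v i) \<le> K" and \<eta>: "\<eta> > 0"
  obtains R where "finite R" "R \<subseteq> X" "\<And>v. v \<in> X \<Longrightarrow> \<exists>r\<in>R. \<forall>i\<in>I. norm (g r i - g v i) \<le> \<eta>"
proof -
  obtain F where F: "finite F" "cball (0::'k) K \<subseteq> (\<Union>p\<in>F. ball p (\<eta> / 2))"
    using cball_finite_cover[of "\<eta> / 2" 0 K] \<eta> by auto
  have "\<exists>p\<in>F. dist p (g v i) < \<eta> / 2" if "v \<in> X" "i \<in> I" for v i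
  proof -
    have "g v i \<in> cball 0 K" using bd[OF that] by simp
    then have "g v i \<in> (\<Union>p\<in>F. ball p (\<eta> / 2))" using F(2) by blast
    then show ?thesis by auto
  qed
  then obtain p where p: "\<And>v i. v \<in> X \<Longrightarrow> i \<in> I \<Longrightarrow> p v i \<in> F \<and> dist (p v i) (g v i) < \<eta> / 2" by metis
  define key where "key v = restrict (p v) I" for v
  have "key ` X \<subseteq> (\<Pi>\<^sub>E i\<in>I. F)" using p by (auto simp: key_def)
  then have fin: "finite (key ` X)" using finite_PiE[of I "\<lambda>_. F"] I F(1) finite_subset by blast
  let ?R = "inv_into X key ` key ` X"
  have "\<exists>r\<in>?R. \<forall>i\<in>I. norm (g r i - g v i) \<le> \<eta>" if v: "v \<in> X" for v
  proof (intro bexI ballI)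
    let ?r = "inv_into X key (key v)"
    have r: "?r \<in> X" "key ?r = key v" using v by (auto intro: inv_into_into f_inv_into_f)
    show "?r \<in> ?R" using v by blast
    fix i assume i: "i \<in> I"
    have "p ?r i = p v i" using r(2) i by (metis key_def restrict_apply')
    then have "dist (g ?r i) (g v i) < \<eta> / 2 + \<eta> / 2"
      using p[OF r(1) i] p[OF v i] by (metis dist_commute dist_triangle_half_l field_sum_of_halves)
    then show "norm (g ?r i - g v i) \<le> \<eta>" by (simp add: dist_norm)
  qed
  moreover have "?R \<subseteq> X" by (auto intro: inv_into_into)
  ultimately show thesis using fin by (intro that[of ?R]) auto
qed

text \<open>
  Each functional splits off at most one dimension from the domain. The statement is about a subspace \<open>S\<close>
  because the induction passes to the kernel of a functional.
\<close>

lemma finite_dimensional_image: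
  fixes s1 :: "'k::field \<Rightarrow> 'a::ab_group_add \<Rightarrow> 'a" and s2 :: "'k \<Rightarrow> 'b::ab_group_add \<Rightarrow> 'b"
  assumes vs1: "vector_space s1" and vs2: "vector_space s2"
    and L: "\<And>x y. L (x + y) = L x + L y" "\<And>k x. L (s1 k x) = s2 k (L x)"
    and "finite F"
    and F: "\<And>l x y. l \<in> F \<Longrightarrow> l (x + y) = l x + l y" "\<And>l k x. l \<in> F \<Longrightarrow> l (s1 k x) = k * l x"
    and ker: "\<And>x. x \<in> S \<Longrightarrow> \<forall>l\<in>F. l x = 0 \<Longrightarrow> L x = 0"
    and S: "module.subspace s1 S"
  shows "finite_dimensional s2 (L ` S)"
proof -
  interpret A: vector_space s1 by fact
  interpret B: vector_space s2 by fact
  from \<open>finite F\<close> F ker S show ?thesis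
  proof (induction F arbitrary: S rule: finite_induct)
    case empty
    have "L ` S \<subseteq> B.span {}" using empty(3) by auto
    then show ?case unfolding finite_dimensional_def by blast
  next
    case (insert l F)
    show ?case
    proof (cases "\<forall>x\<in>S. l x = 0")
      case True
      then show ?thesis using insert by (intro insert.IH) auto
    next
      case False
      then obtain x0 where x0: "x0 \<in> S" "l x0 \<noteq> 0" by blast
      have l: "l (x + y) = l x + l y" "l (s1 k x) = k * l x" for x y k using insert.prems(1,2) by auto
      have l0: "l 0 = 0" using l(2)[of 0 0] by simp
      let ?S = "{x \<in> S. l x = 0}"
      have "A.subspace ?S"
        using insert.prems(4) by (intro A.subspaceI) (auto simp: l l0 A.subspace_0 A.subspace_add A.subspace_scale)
      then have "finite_dimensional s2 (L ` ?S)"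
        using insert.prems by (intro insert.IH) auto
      then obtain B where B: "finite B" "L ` ?S \<subseteq> B.span B" by (auto simp: finite_dimensional_def)
      have "L x \<in> B.span (insert (L x0) B)" if x: "x \<in> S" for x
      proof -
        let ?k = "l x / l x0"
        have l_neg: "l (s1 (- ?k) x0) = - l x" using x0 by (simp only: l) simp
        have "x + s1 (- ?k) x0 \<in> ?S"
          using x x0 insert.prems(4) l_neg
          by (auto simp: l(1) intro!: A.subspace_add A.subspace_scale simp del: A.scale_minus_left)
        then have "L (x + s1 (- ?k) x0) \<in> B.span B" using B by blast
        then have "L x + s2 (- ?k) (L x0) \<in> B.span B" by (simp only: L)
        then have "L x + s2 (- ?k) (L x0) \<in> B.span (insert (L x0) B)"
          using B.span_mono[of B "insert (L x0) B"] by blast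
        moreover have "s2 ?k (L x0) \<in> B.span (insert (L x0) B)"
          by (intro B.span_scale B.span_base) simp
        ultimately have "(L x + s2 (- ?k) (L x0)) + s2 ?k (L x0) \<in> B.span (insert (L x0) B)"
          by (rule B.span_add)
        then show ?thesis by simp
      qed
      then show ?thesis using B(1) unfolding finite_dimensional_def
        by (intro exI[of _ "insert (L x0) B"]) auto
    qed
  qed
qed

context diagonal_module
begin

text \<open>
  Replacing the values \<open>f v j (d\<^sub>k v)\<close> by those at a representative \<open>r\<close> of \<open>v\<close> leaves only finitely many
  functionals of \<open>a\<close> on which \<open>a \<Psi>\<close> depends up to the tail. The representative has to be taken in the
  pair of functional and vector at once, while \<open>x v j\<close> may depend on \<open>v\<close>. The errors below add up to
  at most half of the operator norm of \<open>a\<close>.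
\<close>

lemma finite_dimensional_if_averageable:
  assumes unif: "\<And>v. norm v \<le> 1 \<Longrightarrow> averageable (1/8) M C v"
  shows "finite_dimensional (pointwise_scale scaleV) (range act)"
proof -
  let ?P = "\<lambda>v p. (\<forall>j<M. bounded_functional scaleV C (fst p j) \<and> norm (snd p j) \<le> C) \<and>
    norm ((\<Sum>j<M. averaged (fst p j) (snd p j) v) - act 1 v) \<le> 1/8"
  define p where "p v = (SOME p. ?P v p)" for v
  define f where "f v = fst (p v)" for v
  define x where "x v = snd (p v)" for v
  have P: "?P v (p v)" if "norm v \<le> 1" for v
  proof -
    have "\<exists>p. ?P v p" using unif[OF that] unfolding averageable_def by auto
    then show ?thesis unfolding p_def by (rule someI_ex)
  qed
  have f: "bounded_functional scaleV C (f v j)" and x: "norm (x v j) \<le> C"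
    if "norm v \<le> 1" "j < M" for v j
    using P[OF that(1)] that(2) by (auto simp: f_def x_def)
  have est: "norm ((\<Sum>j<M. averaged (f v j) (x v j) v) - act 1 v) \<le> 1/8" if "norm v \<le> 1" for v
    using P[OF that] by (simp add: f_def x_def)
  define C' where "C' = \<bar>C\<bar>"
  have C': "C' \<ge> 0" by (simp add: C'_def)
  have f_add: "f v j (y + z) = f v j y + f v j z" and f_scale: "f v j (scaleV k y) = k * f v j y"
    and f_bd: "norm (f v j y) \<le> C' * norm y" if "norm v \<le> 1" "j < M" for v j y z k
    using f[OF that] mult_right_mono[of C C' "norm y"]
    unfolding bounded_functional_def by (auto simp: C'_def intro: order_trans)
  have x_bd: "norm (x v j) \<le> C'" if "norm v \<le> 1" "j < M" for v j
    using x[OF that] by (simp add: C'_def)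
  have f_d: "norm (f v j (act (d k) u)) \<le> (C' * B * e) * norm (d k)" if "norm v \<le> 1" "j < M" "norm u \<le> e" for v j k u e
  proof -
    have "norm (f v j (act (d k) u)) \<le> C' * (B * (norm (d k) * norm u))"
      using f_bd[OF that(1,2), of "act (d k) u"] mult_left_mono[OF norm_act[of "d k" u] C'] by linarith
    also have "\<dots> \<le> C' * (B * (norm (d k) * e))"
      using that(3) C' B_nonneg by (intro mult_left_mono) auto
    finally show ?thesis by (simp add: mult_ac)
  qed
  obtain m where m: "(B * M * C' * (2 * C' * B)) * tail m \<le> 1/8" using tail_small[of "1/8" "B * M * C' * (2 * C' * B)"] by auto
  define Q where "Q = (\<Sum>k<m. norm (c k)) * (B * M * C')"
  have Q: "Q \<ge> 0" using C' B_nonneg by (auto simp: Q_def intro!: mult_nonneg_nonneg sum_nonneg)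
  define \<eta> where "\<eta> = 1 / (8 * (Q + 1))"
  have \<eta>: "\<eta> > 0" "Q * \<eta> \<le> 1/8" using Q by (auto simp: \<eta>_def field_simps)
  obtain D where D: "\<And>k. k < m \<Longrightarrow> norm (d k) \<le> D" "D \<ge> 0"
  proof
    show "norm (d k) \<le> (\<Sum>k<m. norm (d k))" if "k < m" for k
      using that by (intro member_le_sum) auto
  qed (simp add: sum_nonneg)
  have key_bound: "norm (f v (snd i) (act (d (fst i)) v)) \<le> (C' * B * 1) * D"
    if "v \<in> {v. norm v \<le> 1}" "i \<in> {..<m} \<times> {..<M}" for v i
  proof -
    have "norm (f v (snd i) (act (d (fst i)) v)) \<le> (C' * B * 1) * norm (d (fst i))"
      using that by (intro f_d) auto
    also have "\<dots> \<le> (C' * B * 1) * D" using that D C' B_nonneg by (intro mult_left_mono) auto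
    finally show ?thesis .
  qed
  have fin: "finite ({..<m} \<times> {..<M})" by simp
  obtain R where R: "finite R" "R \<subseteq> {v. norm v \<le> 1}" and
    rep: "\<And>v. v \<in> {v. norm v \<le> 1} \<Longrightarrow> \<exists>r\<in>R. \<forall>i\<in>{..<m} \<times> {..<M}.
        norm (f r (snd i) (act (d (fst i)) r) - f v (snd i) (act (d (fst i)) v)) \<le> \<eta>"
    using finite_representatives[where g = "\<lambda>v i. f v (snd i) (act (d (fst i)) v)", OF fin key_bound \<eta>(1)]
    by blast
  define F where "F = (\<lambda>(r, k, j) a. f r j (act (d k) (act a r))) ` (R \<times> {..<m} \<times> {..<M})"
  have kernel: "act a = 0" if a: "\<forall>l\<in>F. l a = 0" for a
  proof -
    have bl: "bounded_linear (act a)" by (rule bounded_linear_right)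
    define o' where "o' = onorm (act a)"
    have o_le: "norm (act a u) \<le> o' * norm u" for u unfolding o'_def by (rule onorm[OF bl])
    have o0: "o' \<ge> 0" unfolding o'_def by (rule onorm_pos_le[OF bl])
    have unit: "norm (act a v) \<le> o' / 2" if v: "norm v \<le> 1" for v
    proof -
      obtain r where r: "r \<in> R" and close: "\<And>k j. k < m \<Longrightarrow> j < M \<Longrightarrow>
          norm (f r j (act (d k) r) - f v j (act (d k) v)) \<le> \<eta>"
        using rep[of v] v by (auto simp: Ball_def)
      have r1: "norm r \<le> 1" using R r by auto
      \<comment> \<open>The functionals and the vector they are applied to come from \<open>r\<close>, the vectors \<open>x v j\<close> from \<open>v\<close>.\<close>
      define \<Psi> where "\<Psi> = (\<Sum>j<M. averaged (f r j) (x v j) r)"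
      have "\<Psi> - (\<Sum>j<M. averaged (f v j) (x v j) v) =
          (\<Sum>k. \<Sum>j<M. scaleV (f r j (act (d k) r) - f v j (act (d k) v)) (act (c k) (x v j)))"
      proof -
        have "averaged (f r j) (x v j) r - averaged (f v j) (x v j) v =
          (\<Sum>k. scaleV (f r j (act (d k) r) - f v j (act (d k) v)) (act (c k) (x v j)))" if "j < M" for j
          unfolding averaged_def V.scale_left_diff_distrib
          by (intro suminf_diff averaged_summable[OF f[OF r1 that]] averaged_summable[OF f[OF v that]])
        moreover have "summable (\<lambda>k. scaleV (f r j (act (d k) r) - f v j (act (d k) v)) (act (c k) (x v j)))"
          if "j < M" for j
          unfolding V.scale_left_diff_distrib by (intro summable_diff averaged_summable[OF f[OF r1 that]] averaged_summable[OF f[OF v that]])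
        ultimately show ?thesis
          unfolding \<Psi>_def by (subst suminf_sum) (simp_all add: sum_subtractf[symmetric])
      qed
      also have "norm \<dots> \<le> (\<Sum>k<m. norm (c k)) * (B * M * C' * \<eta>) + (B * M * C' * (2 * C' * B)) * tail m"
      proof (rule norm_averaging_le(2)[OF _ x_bd[OF v] C' close])
        show "norm (f r j (act (d k) r) - f v j (act (d k) v)) \<le> (2 * C' * B) * norm (d k)" if "j < M" for k j
          using norm_triangle_ineq4[of "f r j (act (d k) r)" "f v j (act (d k) v)"]
            f_d[OF r1 that r1, of k] f_d[OF v that v, of k] by simp
      qed
      also have "(\<Sum>k<m. norm (c k)) * (B * M * C' * \<eta>) = Q * \<eta>" by (simp add: Q_def mult_ac)
      finally have "norm (\<Psi> - (\<Sum>j<M. averaged (f v j) (x v j) v)) \<le> 1/8 + 1/8"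
        using \<eta>(2) m by linarith
      then have "norm (\<Psi> - act 1 v) \<le> 3/8"
        using est[OF v] norm_triangle_ineq[of "\<Psi> - (\<Sum>j<M. averaged (f v j) (x v j) v)"
            "(\<Sum>j<M. averaged (f v j) (x v j) v) - act 1 v"] by simp
      then have 1: "norm (act a (\<Psi> - act 1 v)) \<le> o' * (3/8)"
        using o_le[of "\<Psi> - act 1 v"] mult_left_mono[OF _ o0] by (meson order_trans)
      have "act a \<Psi> = (\<Sum>j<M. averaged (f r j) (x v j) (act a r))"
        unfolding \<Psi>_def sum_right using act_averaged[OF f[OF r1]] by simp
      also have "\<dots> = (\<Sum>k. \<Sum>j<M. scaleV (f r j (act (d k) (act a r))) (act (c k) (x v j)))"
        by (rule sum_averaged[OF f[OF r1]])
      also have "norm \<dots> \<le> (\<Sum>k<m. norm (c k)) * (B * M * C' * 0) + (B * M * C' * (C' * B * o')) * tail m"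
      proof (rule norm_averaging_le(2)[OF _ x_bd[OF v] C'])
        have "norm (act a r) \<le> o'" using o_le[of r] mult_left_mono[OF r1 o0] by simp
        then show "norm (f r j (act (d k) (act a r))) \<le> (C' * B * o') * norm (d k)" if "j < M" for k j
          by (rule f_d[OF r1 that])
        show "norm (f r j (act (d k) (act a r))) \<le> 0" if "k < m" "j < M" for k j
          using a r that by (force simp: F_def)
      qed
      also have "\<dots> = o' * ((B * M * C' * (2 * C' * B)) * tail m) / 2" by (simp add: mult_ac)
      also have "\<dots> \<le> o' * (1/8) / 2" using m o0 by (intro divide_right_mono mult_left_mono) auto
      finally have 2: "norm (act a \<Psi>) \<le> o' / 8" using o0 by simp
      have "act a v = act a \<Psi> - act a (\<Psi> - act 1 v)" by (simp add: diff_right act_act_one)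
      then show ?thesis using norm_triangle_ineq4[of "act a \<Psi>" "act a (\<Psi> - act 1 v)"] 1 2 o0 by simp
    qed
    have "norm (act a v) \<le> (o' / 2) * norm v" for v
    proof (cases "v = 0")
      case False
      then have "norm (act a (v /\<^sub>R norm v)) \<le> o' / 2" by (intro unit) simp
      then show ?thesis using False by (simp add: scaleR_right field_simps)
    qed (simp add: zero_right)
    then have "o' \<le> o' / 2" unfolding o'_def using onorm_bound[of "o' / 2" "act a"] o0 by (simp add: o'_def)
    then have "o' = 0" using o0 by simp
    then show ?thesis using o_le by (simp add: fun_eq_iff)
  qed
  show ?thesis
  proof (rule finite_dimensional_image[where S = UNIV and F = F and ?s1.0 = scaleA])
    show "vector_space scaleA" by (rule A.vector_space_axioms)
    show "vector_space (pointwise_scale scaleV)" by (rule V.vector_space_pointwise)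
    show "act (a + b) = act a + act b" for a b by (simp add: fun_eq_iff add_left)
    show "act (scaleA k a) = pointwise_scale scaleV k (act a)" for k a
      by (simp add: fun_eq_iff pointwise_scale_def act_scale_left)
    show "finite F" using R by (simp add: F_def)
    show "l (a + b) = l a + l b" if "l \<in> F" for l a b
      using that R by (auto simp: F_def add_left add_right f_add)
    show "l (scaleA k a) = k * l a" if "l \<in> F" for l k a
      using that R by (auto simp: F_def act_scale_left act_scale_right f_scale)
    show "A.subspace UNIV" by (rule A.subspace_UNIV)
  qed (use kernel in auto)
qed

end


section \<open>Uniform averaging from ultrapowers\<close>

context diagonal_module
begin

text \<open>
  The families \<open>D k\<close> represent \<open>d\<^sub>k w\<close> in the ultrapower. Scaled by \<open>\<gamma> k\<close> they form a null sequence, so the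
  approximation property applies to them, while the series of the errors still converges because of
  the choice of \<open>\<rho>\<close>. The number \<open>m\<close> of terms that are treated by descent to the \<open>i\<close>-th
  component is fixed after the operator \<open>T\<close>, as the bound on the other terms involves its rank and norm.
\<close>

lemma eventually_averageable:
  fixes U :: "'i filter" and w :: "'i \<Rightarrow> 'v"
  assumes U: "ultrafilter U" and AP: "approximation_property (ultrapower scaleV U)"
    and w: "\<And>i. norm (w i) \<le> 1" and \<epsilon>: "\<epsilon> > 0"
  shows "\<exists>M C. \<forall>\<^sub>F i in U. averageable \<epsilon> M C (w i)"
proof -
  interpret X: ultrapower_over scaleV U
    using V.normed_space_over_axioms U by (simp add: ultrapower_over_def ultrapower_over_axioms_def)
  let ?E = "ultrapower scaleV U"
  let ?N = "ultra_norm scaleV U"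
  interpret E: Metric_space "pts ?E" "ndist ?E" by (rule V.Metric_space_ultrapower[OF U])
  define D where "D k = (\<lambda>i. act (d k) (w i))" for k
  have D_bd: "norm (D k i) \<le> B * norm (d k)" for k i
  proof -
    have "norm (D k i) \<le> B * (norm (d k) * norm (w i))" unfolding D_def by (rule norm_act)
    also have "\<dots> \<le> B * (norm (d k) * 1)" using w B_nonneg by (intro mult_left_mono) auto
    finally show ?thesis by simp
  qed
  have D_in: "D k \<in> bounded_families" for k using D_bd by (auto simp: bounded_families_iff)
  have N_D: "?N (D k) \<le> B * norm (d k)" for k
    by (rule tendsto_upperbound[OF X.ultra_norm_tendsto[OF D_in]]) (auto simp: X.nontrivial D_bd)
  obtain \<rho> where \<rho>: "\<And>k. \<rho> k \<ge> 0" "\<And>k. weight k > 0 \<Longrightarrow> \<rho> k > 0" "\<rho> \<longlonglongrightarrow> 0" "summable (\<lambda>k. weight k / \<rho> k)"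
    using summable_div_null_sequence[OF weight] by blast
  define \<gamma> where "\<gamma> k = (if weight k = 0 then 0 else \<rho> k / norm (d k))" for k
  have \<gamma>0: "\<gamma> k \<ge> 0" for k using \<rho>(1) by (simp add: \<gamma>_def)
  define Y where "Y k = pointwise_scale scaleV (of_real (\<gamma> k)) (D k)" for k
  have Y_in: "Y k \<in> bounded_families" for k unfolding Y_def by (rule V.bounded_families_scale[OF D_in])
  have N_Y: "?N (Y k) = \<gamma> k * ?N (D k)" for k
    unfolding Y_def using X.F.N_scale[OF D_in] \<gamma>0 by simp
  have N_Y_le: "?N (Y k) \<le> B * \<rho> k" for k
  proof (cases "weight k = 0")
    case True
    then show ?thesis using N_Y[of k] \<rho>(1)[of k] B_nonneg by (simp add: \<gamma>_def)
  next
    case False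
    then have "norm (d k) > 0" by (auto simp: weight_def)
    moreover have "?N (Y k) \<le> \<gamma> k * (B * norm (d k))"
      unfolding N_Y by (intro mult_left_mono N_D \<gamma>0)
    ultimately show ?thesis using False by (simp add: \<gamma>_def mult_ac)
  qed
  have zero_in: "(\<lambda>_::'i. 0::'v) \<in> bounded_families" by (auto simp: bounded_families_iff)
  have compact: "compactin (ntopology ?E) (insert (ultra_class U (\<lambda>_. 0)) (range (\<lambda>k. ultra_class U (Y k))))"
  proof (rule compactin_sequence_with_limit)
    have "ndist ?E (ultra_class U (Y k)) (ultra_class U (\<lambda>_. 0)) = ?N (Y k)" for k
      using V.ndist_ultra_class[OF Y_in zero_in, of U] by (simp add: fun_diff_def)
    moreover have "(\<lambda>k. ?N (Y k)) \<longlonglongrightarrow> 0"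
    proof (rule tendsto_sandwich[OF _ _ tendsto_const tendsto_mult_right_zero[OF \<rho>(3), of B]])
      show "\<forall>\<^sub>F k in sequentially. 0 \<le> ?N (Y k)" by (simp add: X.F.N_nonneg Y_in)
      show "\<forall>\<^sub>F k in sequentially. ?N (Y k) \<le> B * \<rho> k" by (simp add: N_Y_le)
    qed
    ultimately show "limitin (ntopology ?E) (\<lambda>k. ultra_class U (Y k)) (ultra_class U (\<lambda>_. 0)) sequentially"
      unfolding ntopology_def E.limitin_metric_dist_null using Y_in zero_in by (simp add: pts_ultrapower imageI)
    show "range (\<lambda>k. ultra_class U (Y k)) \<subseteq> topspace (ntopology ?E)"
      unfolding ntopology_def E.topspace_mtopology using Y_in by (auto simp: pts_ultrapower)
  qed simp
  define S where "S = (\<Sum>k. weight k / \<rho> k)"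
  have S: "S \<ge> 0" unfolding S_def using \<rho> weight by (intro suminf_nonneg) auto
  define \<delta> where "\<delta> = (\<epsilon> / 4) / (B * S + 1)"
  have BS: "B * S + 1 > 0" using B_nonneg S by (intro add_nonneg_pos mult_nonneg_nonneg) auto
  have \<delta>: "\<delta> > 0" using \<epsilon> BS by (simp add: \<delta>_def)
  have \<delta>_le: "B * (\<delta> * S) \<le> \<epsilon> / 4"
  proof -
    have "B * (\<delta> * S) \<le> \<delta> * (B * S + 1)" using \<delta> by (simp add: algebra_simps)
    also have "\<dots> = \<epsilon> / 4"
      unfolding \<delta>_def by (rule nonzero_eq_divide_eq[THEN iffD1, OF _ refl]) (use BS in linarith)
    finally show ?thesis .
  qed
  obtain T where T: "bounded_operator ?E T" "finite_rank ?E T"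
    "\<And>k. ndist ?E (T (ultra_class U (Y k))) (ultra_class U (Y k)) < \<delta>"
  proof -
    obtain F where F: "F \<noteq> bot" "\<forall>\<^sub>F f in F. bounded_operator ?E f \<and> finite_rank ?E f"
      "\<And>K e. compactin (ntopology ?E) K \<Longrightarrow> e > 0 \<Longrightarrow> \<forall>\<^sub>F f in F. \<forall>x\<in>K. ndist ?E (f x) x < e"
      using AP unfolding approximation_property_def by blast
    from eventually_happens'[OF F(1) eventually_conj[OF F(2) F(3)[OF compact \<delta>]]]
    show ?thesis using that by blast
  qed
  obtain J \<phi> C where J: "finite J" "J \<subseteq> bounded_families" and C: "C \<ge> 0"
    and T_eq: "\<And>y. y \<in> bounded_families \<Longrightarrow> T (ultra_class U y) = ultra_class U (X.F.comb J (\<lambda>b. \<phi> b y))"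
    and \<phi>_scale: "\<And>b k y. b \<in> J \<Longrightarrow> y \<in> bounded_families \<Longrightarrow> \<phi> b (pointwise_scale scaleV k y) = k * \<phi> b y"
    and \<phi>_bd: "\<And>b Y s. b \<in> J \<Longrightarrow> finite Y \<Longrightarrow> Y \<subseteq> bounded_families \<Longrightarrow>
        norm (\<Sum>y\<in>Y. s y * \<phi> b y) \<le> C * ?N (X.F.comb Y s)"
    by (rule X.finite_rank_coordinates[OF T(1,2)]) blast
  define e where "e k = X.F.comb J (\<lambda>b. \<phi> b (D k)) - D k" for k
  have comb_in: "X.F.comb J t \<in> bounded_families" for t by (rule X.F.comb_in[OF J(2)])
  have e_in: "e k \<in> bounded_families" for k unfolding e_def by (intro bounded_families_diff comb_in D_in)
  have N_e: "\<gamma> k * ?N (e k) < \<delta>" for k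
  proof -
    have "X.F.comb J (\<lambda>b. \<phi> b (Y k)) = X.F.comb J (\<lambda>b. of_real (\<gamma> k) * \<phi> b (D k))"
      unfolding X.F.comb_def Y_def by (intro sum.cong) (simp_all add: \<phi>_scale D_in)
    then have "X.F.comb J (\<lambda>b. \<phi> b (Y k)) - Y k = pointwise_scale scaleV (of_real (\<gamma> k)) (e k)"
      unfolding e_def X.F.comb_scale Y_def by (simp only: X.F.scale_right_diff_distrib)
    then have "?N (X.F.comb J (\<lambda>b. \<phi> b (Y k)) - Y k) = \<gamma> k * ?N (e k)"
      using X.F.N_scale[OF e_in] \<gamma>0 by simp
    then show ?thesis
      using T(3)[of k] unfolding T_eq[OF Y_in] V.ndist_ultra_class[OF comb_in Y_in] by simp
  qed
  have c_N_e: "norm (c k) * ?N (e k) \<le> \<delta> * (weight k / \<rho> k)" for k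
  proof (cases "weight k = 0")
    case True
    then consider "c k = 0" | "d k = 0" by (auto simp: weight_def)
    then show ?thesis
    proof cases
      case 2
      then have D0: "D k = (\<lambda>_. 0)" by (simp add: D_def zero_left)
      have "\<phi> b (D k) = 0" if "b \<in> J" for b
        using \<phi>_scale[OF that zero_in, of 0] by (simp add: D0 pointwise_scale_def)
      then have "e k = 0" unfolding e_def X.F.comb_def by (simp add: D0 fun_eq_iff)
      then show ?thesis using True X.F.N_zero by simp
    qed (use True in simp)
  next
    case False
    then have pos: "norm (d k) > 0" "\<rho> k > 0" using \<rho>(2)[of k] weight(2)[of k] by (auto simp: weight_def less_le)
    then have "?N (e k) \<le> \<delta> * norm (d k) / \<rho> k"
      using N_e[of k] False by (simp add: \<gamma>_def field_simps)
    from mult_left_mono[OF this norm_ge_zero[of "c k"]] show ?thesis by (simp add: weight_def mult_ac)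
  qed
  obtain \<kappa> where \<kappa>: "\<kappa> > 0" and descent: "\<And>Y (\<phi> :: ('i \<Rightarrow> 'v) \<Rightarrow> 'k) C \<eta>.
     finite Y \<Longrightarrow> Y \<subseteq> bounded_families \<Longrightarrow> C \<ge> 0 \<Longrightarrow> \<eta> > 0 \<Longrightarrow>
     (\<And>s. norm (\<Sum>y\<in>Y. s y * \<phi> y) \<le> C * ?N (X.F.comb Y s)) \<Longrightarrow>
     \<forall>\<^sub>F n in U. \<exists>f. bounded_functional scaleV (\<kappa> * C) f \<and> (\<forall>y\<in>Y. norm (f (y n) - \<phi> y) < \<eta>)"
    by (rule X.functional_descent) blast
  define M where "M = card J"
  obtain \<beta> where \<beta>: "bij_betw \<beta> {..<M} J"
    using ex_bij_betw_nat_finite[OF J(1)] by (auto simp: M_def atLeast0LessThan)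
  have \<beta>J: "\<beta> j \<in> J" if "j < M" for j using \<beta> that by (auto simp: bij_betw_def)
  have "\<forall>b\<in>J. \<exists>K. \<forall>i. norm (b i) \<le> K" using J(2) by (auto simp: bounded_families_iff)
  then obtain K where K: "\<And>b i. b \<in> J \<Longrightarrow> norm (b i) \<le> K b" by metis
  define C' where "C' = \<kappa> * C + (\<Sum>b\<in>J. \<bar>K b\<bar>)"
  have C': "C' \<ge> 0" "\<kappa> * C \<le> C'" using \<kappa> C by (auto simp: C'_def intro!: add_nonneg_nonneg sum_nonneg)
  have b_bd: "norm (b i) \<le> C'" if "b \<in> J" for b i
  proof -
    have "norm (b i) \<le> \<bar>K b\<bar>" using K[OF that, of i] by linarith
    also have "\<dots> \<le> (\<Sum>b\<in>J. \<bar>K b\<bar>)" using that J(1) by (intro member_le_sum) auto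
    also have "\<dots> \<le> C'" using \<kappa> C by (simp add: C'_def)
    finally show ?thesis .
  qed
  define L where "L = B * (M * C' * C' * B + B)"
  obtain m where m: "L * tail m \<le> \<epsilon> / 4" using tail_small[of "\<epsilon> / 4" L] \<epsilon> by auto
  define Q where "Q = B * (1 + M * C') * (\<Sum>k<m. norm (c k))"
  have Q: "Q \<ge> 0" using B_nonneg C' by (auto simp: Q_def intro!: mult_nonneg_nonneg sum_nonneg add_nonneg_nonneg)
  define \<eta> where "\<eta> = \<epsilon> / (4 * (Q + 1))"
  have \<eta>: "\<eta> > 0" "Q * \<eta> \<le> \<epsilon> / 4" using Q \<epsilon> by (auto simp: \<eta>_def field_simps)
  have "\<forall>\<^sub>F i in U. \<forall>b\<in>J. \<exists>f. bounded_functional scaleV (\<kappa> * C) f \<and>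
      (\<forall>y\<in>D ` {..<m}. norm (f (y i) - \<phi> b y) < \<eta>)"
    using J(1) D_in by (intro eventually_ball_finite ballI descent C \<eta>(1) \<phi>_bd) auto
  moreover have "\<forall>\<^sub>F i in U. \<forall>k\<in>{..<m}. norm (e k i) < ?N (e k) + \<eta>"
    using \<eta>(1) by (intro eventually_ball_finite ballI order_tendstoD(2)[OF X.ultra_norm_tendsto[OF e_in]]) auto
  ultimately have "\<forall>\<^sub>F i in U. averageable \<epsilon> M C' (w i)"
  proof eventually_elim
    case (elim i)
    obtain f where f: "\<And>b. b \<in> J \<Longrightarrow> bounded_functional scaleV (\<kappa> * C) (f b)"
      and close: "\<And>b k. b \<in> J \<Longrightarrow> k < m \<Longrightarrow> norm (f b (D k i) - \<phi> b (D k)) < \<eta>"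
    proof -
      from bchoice[OF elim(1)] show ?thesis using that by blast
    qed
    have f': "bounded_functional scaleV C' (f b)" if "b \<in> J" for b
      using f[OF that] mult_right_mono[OF C'(2) norm_ge_zero]
      unfolding bounded_functional_def by (meson order_trans)
    \<comment> \<open>The error of the pulled back operator at \<open>d\<^sub>k (w i)\<close>. For \<open>k < m\<close> it is compared with the error \<open>e k\<close> in the ultrapower.\<close>
    define z where "z k = (\<Sum>j<M. scaleV (f (\<beta> j) (D k i)) (\<beta> j i)) - D k i" for k
    have z_bd: "norm (z k) \<le> (M * C' * C' * B + B) * norm (d k)" for k
    proof -
      have "norm (\<Sum>j<M. scaleV (f (\<beta> j) (D k i)) (\<beta> j i)) \<le> (\<Sum>j<M. C' * (B * norm (d k)) * C')"
      proof (rule sum_norm_le)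
        fix j assume "j \<in> {..<M}"
        then have j: "\<beta> j \<in> J" using \<beta>J by simp
        have "norm (f (\<beta> j) (D k i)) \<le> C' * norm (D k i)" using f'[OF j] by (simp add: bounded_functional_def)
        also have "\<dots> \<le> C' * (B * norm (d k))" by (intro mult_left_mono D_bd C')
        finally show "norm (scaleV (f (\<beta> j) (D k i)) (\<beta> j i)) \<le> C' * (B * norm (d k)) * C'"
          unfolding V.norm_scale using b_bd[OF j] C' B_nonneg by (intro mult_mono) auto
      qed
      then show ?thesis
        unfolding z_def using D_bd[of k i] norm_triangle_ineq4[of "\<Sum>j<M. scaleV (f (\<beta> j) (D k i)) (\<beta> j i)" "D k i"]
        by (simp add: algebra_simps)
    qed
    have z_small: "norm (z k) \<le> ?N (e k) + (1 + M * C') * \<eta>" if k: "k < m" for k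
    proof -
      have "e k i = (\<Sum>j<M. scaleV (\<phi> (\<beta> j) (D k)) (\<beta> j i)) - D k i"
        unfolding e_def fun_diff_def X.comb_apply by (simp add: sum.reindex_bij_betw[OF \<beta>, symmetric])
      then have "z k - e k i = (\<Sum>j<M. scaleV (f (\<beta> j) (D k i) - \<phi> (\<beta> j) (D k)) (\<beta> j i))"
        by (simp add: z_def V.scale_left_diff_distrib sum_subtractf)
      also have "norm \<dots> \<le> (\<Sum>j<M. \<eta> * C')"
      proof (rule sum_norm_le)
        fix j assume "j \<in> {..<M}"
        then have j: "\<beta> j \<in> J" using \<beta>J by simp
        show "norm (scaleV (f (\<beta> j) (D k i) - \<phi> (\<beta> j) (D k)) (\<beta> j i)) \<le> \<eta> * C'"
          unfolding V.norm_scale using close[OF j k] b_bd[OF j] \<eta>(1) by (intro mult_mono) auto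
      qed
      finally show ?thesis
        using elim(2) k norm_triangle_ineq[of "z k - e k i" "e k i"] by (force simp: algebra_simps)
    qed
    have "(\<lambda>k. act (c k) (z k)) sums ((\<Sum>j<M. averaged (f (\<beta> j)) (\<beta> j i) (w i)) - act 1 (w i))"
    proof -
      have "(\<lambda>k. \<Sum>j<M. scaleV (f (\<beta> j) (act (d k) (w i))) (act (c k) (\<beta> j i))) sums
          (\<Sum>j<M. averaged (f (\<beta> j)) (\<beta> j i) (w i))"
        unfolding averaged_def by (intro sums_sum summable_sums averaged_summable[OF f]) (use \<beta>J in auto)
      from sums_diff[OF this act_one_sums[of "w i"]] show ?thesis
        by (simp add: z_def D_def diff_right sum_right act_scale_right)
    qed
    then have "(\<Sum>j<M. averaged (f (\<beta> j)) (\<beta> j i) (w i)) - act 1 (w i) = (\<Sum>k. act (c k) (z k))"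
      by (rule sums_unique)
    also have "norm \<dots> \<le> (\<Sum>k<m. B * (norm (c k) * ?N (e k)) + B * (1 + M * C') * norm (c k) * \<eta>) + L * tail m"
      unfolding tail_def
    proof (rule norm_suminf_split_le(2)[OF weight(1)])
      fix k
      have "norm (act (c k) (z k)) \<le> B * (norm (c k) * norm (z k))" by (rule norm_act)
      also have "\<dots> \<le> B * (norm (c k) * ((M * C' * C' * B + B) * norm (d k)))"
        by (intro mult_left_mono z_bd B_nonneg norm_ge_zero)
      finally show "norm (act (c k) (z k)) \<le> L * weight k" by (simp add: L_def weight_def mult_ac)
    next
      fix k assume k: "k < m"
      have "norm (act (c k) (z k)) \<le> B * (norm (c k) * norm (z k))" by (rule norm_act)
      also have "\<dots> \<le> B * (norm (c k) * (?N (e k) + (1 + M * C') * \<eta>))"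
        by (intro mult_left_mono z_small B_nonneg norm_ge_zero k)
      finally show "norm (act (c k) (z k)) \<le> B * (norm (c k) * ?N (e k)) + B * (1 + M * C') * norm (c k) * \<eta>"
        by (simp add: algebra_simps)
    qed
    also have "\<dots> = B * (\<Sum>k<m. norm (c k) * ?N (e k)) + Q * \<eta> + L * tail m"
      by (simp add: sum.distrib sum_distrib_left sum_distrib_right Q_def)
    also have "\<dots> \<le> B * (\<delta> * S) + \<epsilon> / 4 + \<epsilon> / 4"
    proof -
      have "(\<Sum>k<m. norm (c k) * ?N (e k)) \<le> (\<Sum>k<m. \<delta> * (weight k / \<rho> k))" by (intro sum_mono c_N_e)
      also have "\<dots> = \<delta> * (\<Sum>k<m. weight k / \<rho> k)" by (simp only: sum_distrib_left)
      also have "\<dots> \<le> \<delta> * S"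
        unfolding S_def using \<delta> \<rho> weight by (intro mult_left_mono sum_le_suminf) auto
      finally have "B * (\<Sum>k<m. norm (c k) * ?N (e k)) \<le> B * (\<delta> * S)" using B_nonneg by (rule mult_left_mono)
      then show ?thesis using \<eta>(2) m by linarith
    qed
    also have "\<dots> \<le> \<epsilon>" using \<delta>_le \<epsilon> by linarith
    finally show ?case
      unfolding averageable_def using f' b_bd \<beta>J
      by (intro exI[of _ "\<lambda>j. f (\<beta> j)"] exI[of _ "\<lambda>j. \<beta> j i"]) auto
  qed
  then show ?thesis by blast
qed

text \<open>
  Vectors \<open>v n\<close> that are not averageable with rank and norm bound \<open>n\<close> cannot form a single vector of an
  ultrapower with the approximation property.
\<close>

lemma averageable_if_UGAP:
  assumes inf: "infinite (UNIV :: 'i set)" and ugap: "UGAP TYPE('i) scaleV" and \<epsilon>: "\<epsilon> > 0"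
  shows "\<exists>M C. \<forall>v. norm v \<le> 1 \<longrightarrow> averageable \<epsilon> M C v"
proof (rule ccontr)
  assume "\<not> ?thesis"
  then have "\<forall>n. \<exists>v. norm v \<le> 1 \<and> \<not> averageable \<epsilon> n (real n) v" by blast
  from choice[OF this] obtain v where v: "\<And>n. norm (v n) \<le> 1" "\<And>n. \<not> averageable \<epsilon> n (real n) (v n)"
    by blast
  obtain U :: "'i filter" and h :: "'i \<Rightarrow> nat" where U: "ultrafilter U" and h: "filterlim h at_top U"
    using ultrafilter_at_top_exists[OF inf] by blast
  have AP: "approximation_property (ultrapower scaleV U)" using ugap U by (simp add: UGAP_def)
  obtain M C where MC: "\<forall>\<^sub>F i in U. averageable \<epsilon> M C (v (h i))"
    using eventually_averageable[OF U AP, of "\<lambda>i. v (h i)"] v(1) \<epsilon> by blast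
  have "\<forall>\<^sub>F i in U. max M (nat \<lceil>C\<rceil>) \<le> h i" using h unfolding filterlim_at_top by blast
  with MC have "\<forall>\<^sub>F i in U. False"
  proof eventually_elim
    case (elim i)
    have "C \<le> real (h i)" using elim(2) by linarith
    then show ?case using averageable_mono[OF elim(1), of "h i" "real (h i)"] elim(2) v(2) by auto
  qed
  then show False using U by (simp add: ultrafilter_def trivial_limit_def)
qed

end

theorem mainTheorem1:
  fixes scaleA :: "'k::{real_normed_field,heine_borel} \<Rightarrow> 'a::{real_normed_algebra,monoid_mult,banach} \<Rightarrow> 'a"
    and scaleV :: "'k \<Rightarrow> 'v::banach \<Rightarrow> 'v"
    and act :: "'a \<Rightarrow> 'v \<Rightarrow> 'v"
  assumes "normed_algebra_over scaleA"
    and "contractible_algebra scaleA"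
    and "left_banach_module scaleA scaleV act"
    and "infinite (UNIV :: 'i set)"
    and "UGAP TYPE('i) scaleV"
  shows "finite_dimensional (pointwise_scale scaleV) {(\<lambda>v. act a v) | a. True}"
proof -
  interpret left_banach_module scaleA scaleV act by fact
  obtain c d where cd: "is_diagonal scaleA c d" using assms(2) by (auto simp: contractible_algebra_def)
  obtain B where B: "B \<ge> 0" "\<And>a v. norm (act a v) \<le> norm a * norm v * B" using nonneg_bounded by blast
  interpret diagonal_module scaleA scaleV act c d B
    by unfold_locales (use cd B in \<open>auto simp: mult_ac\<close>)
  obtain M C where "\<And>v. norm v \<le> 1 \<Longrightarrow> averageable (1/8) M C v"
    using averageable_if_UGAP[OF assms(4,5), of "1/8"] by auto
  then have "finite_dimensional (pointwise_scale scaleV) (range act)"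
    by (rule finite_dimensional_if_averageable)
  moreover have "{(\<lambda>v. act a v) | a. True} = range act" by auto
  ultimately show ?thesis by simp
qed

end
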